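(* Let $D_\Lambda\subset\mathrm{UC}_\kappa$ be the linear space of all $u\in\mathrm{UC}_\kappa$ for which there exist $L_u\ge0$ and $h_u>0$ such that $\sup_{\lambda\in\Lambda}\|S_\lambda(h)u-u\|_\kappa\le L_uh$ for all $h\in[0,h_u)$. Then the semigroup envelope $\mathscr{S}$ is strongly continuous on the closure $\overline{D_\Lambda}$ of $D_\Lambda$ in $\mathrm{UC}_\kappa$, i.e. $[0,\infty)\to\mathrm{UC}_\kappa$, $t\mapsto\mathscr{S}(t)u$ is continuous for every $u\in\overline{D_\Lambda}$. In particular, $\mathscr{S}$ is strongly continuous (on $\mathrm{UC}_\kappa$) if $D_\Lambda$ is dense in $\mathrm{UC}_\kappa$.
   Context: Setting: $\Lambda$ is a nonempty set, $(M,d)$ is a separable metric space, and $\kappa\colon M\to(0,\infty)$ is continuous and bounded. $\|u\|_\infty=\sup_{x\in M}|u(x)|$; $\|u\|_\kappa=\|\kappa u\|_\infty$; $\|u\|_{\mathrm{Lip}}=\inf\{L\ge 0: |u(x)-u(y)|\le L d(x,y)\ \forall x,y\in M\}$. $\mathrm{C}_\kappa$ is the space of continuous $u\colon M\to\mathbb{R}$ with $\|u\|_\kappa<\infty$; $\mathrm{Lip}_{\rm b}$ is the space of bounded Lipschitz functions $M\to\mathbb{R}$; $\mathrm{UC}_\kappa$ is the closure of $\mathrm{Lip}_{\rm b}$ in $(\mathrm{C}_\kappa,\|\cdot\|_\kappa)$; topological notions in $\mathrm{UC}_\kappa$ are w.r.t. $\|\cdot\|_\kappa$. For $u_n,u\in\mathrm{UC}_\kappa$,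 $u_n\nearrow u$ means $u_n\le u_{n+1}$ for all $n$ and $u_n(x)\to u(x)$ for all $x\in M$. A Feller semigroup is a family $T=(T(t))_{t\ge0}$ of possibly nonlinear operators such that (i) $T(t)\colon\mathrm{UC}_\kappa\to\mathrm{UC}_\kappa$ is continuous for all $t\ge 0$; (ii) $T(0)u=u$ and $T(s+t)u=T(s)T(t)u$ for all $s,t\ge0$, $u\in\mathrm{UC}_\kappa$; (iii) each $T(t)$ is monotone and continuous from below, i.e. $u_n\nearrow u$ in $\mathrm{UC}_\kappa$ implies $T(t)u_n\nearrow T(t)u$. Standing assumptions: (A1) for every $\lambda\in\Lambda$, $S_\lambda=(S_\lambda(t))_{t\ge0}$ is a Feller semigroup of linear operators with $S_\lambda(t)1=1$ for all $t\geq 0$; (A2) there are $\alpha,\beta\in\mathbb{R}$ with $\|S_\lambda(t)u\|_\kappa\le e^{\alpha t}\|u\|_\kappa$ and $\|S_\lambda(t)u\|_{\mathrm{Lip}}\le e^{\beta t}\|u\|_{\mathrm{Lip}}$ for all $u\in\mathrm{Lip}_{\rm b}$, $\lambda\in\Lambda$, $t\ge0$. For $h\ge0$, $u\in\mathrm{UC}_\kappa$: $(\mathcal{E}_hu)(x)=\sup_{\lambda\in\Lambda}(S_\lambda(h)u)(x)$; $\mathcal{E}_h$ maps $\mathrm{UC}_\kappa$ to itself. $P$ is the set of finite subsets $\pi\subset[0,\infty)$ with $0\in\pi$, and $P_t=\{\pi\in P:\max\pi=t\}$. For $\pi=\{t_0,\dots,t_m\}$ with $0=t_0<t_1<\dots<t_m$,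 $m\ge 1$, $\mathcal{E}_\pi u=\mathcal{E}_{t_1-t_0}\cdots\mathcal{E}_{t_m-t_{m-1}}u$ (composition), and $\mathcal{E}_{\{0\}}u=u$. The semigroup envelope $\mathscr{S}=(\mathscr{S}(t))_{t\ge0}$ is $(\mathscr{S}(t)u)(x)=\sup_{\pi\in P_t}(\mathcal{E}_\pi u)(x)$ for $t\ge0$, $u\in\mathrm{UC}_\kappa$, $x\in M$; it is a Feller semigroup. *)

theory Defs
  imports "HOL-Analysis.Analysis"
begin

section \<open>Weighted function spaces\<close>

text \<open>The metric space is a whole type of class \<^class>\<open>metric_space\<close>. Both (semi)norms are
  \<^typ>\<open>ennreal\<close>-valued, so that they are \<^term>\<open>\<infinity> :: ennreal\<close> for functions that are not
  weighted-bounded or not Lipschitz (note that \<^term>\<open>Inf {} = (\<infinity> :: ennreal)\<close>).\<close>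

definition knorm :: "('a \<Rightarrow> real) \<Rightarrow> ('a \<Rightarrow> real) \<Rightarrow> ennreal" where
  "knorm \<kappa> u = (SUP x. ennreal \<bar>\<kappa> x * u x\<bar>)"

definition lip_norm :: "('a::metric_space \<Rightarrow> real) \<Rightarrow> ennreal" where
  "lip_norm u = Inf {ennreal L | L. 0 \<le> L \<and> (\<forall>x y. \<bar>u x - u y\<bar> \<le> L * dist x y)}"

definition C_kappa :: "('a::metric_space \<Rightarrow> real) \<Rightarrow> ('a \<Rightarrow> real) set" where
  "C_kappa \<kappa> = {u. continuous_on UNIV u \<and> knorm \<kappa> u < \<infinity>}"

definition Lip_b :: "('a::metric_space \<Rightarrow> real) set" where
  "Lip_b = {u. bounded (range u) \<and> (\<exists>L. L-lipschitz_on UNIV u)}"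

definition kdist :: "('a \<Rightarrow> real) \<Rightarrow> ('a \<Rightarrow> real) \<Rightarrow> ('a \<Rightarrow> real) \<Rightarrow> real" where
  "kdist \<kappa> u v = enn2real (knorm \<kappa> (\<lambda>x. u x - v x))"

definition C_kappa_top :: "('a::metric_space \<Rightarrow> real) \<Rightarrow> ('a \<Rightarrow> real) topology" where
  "C_kappa_top \<kappa> = Metric_space.mtopology (C_kappa \<kappa>) (kdist \<kappa>)"

definition UC_kappa :: "('a::metric_space \<Rightarrow> real) \<Rightarrow> ('a \<Rightarrow> real) set" where
  "UC_kappa \<kappa> = C_kappa_top \<kappa> closure_of Lip_b"

definition UC_kappa_top :: "('a::metric_space \<Rightarrow> real) \<Rightarrow> ('a \<Rightarrow> real) topology" where
  "UC_kappa_top \<kappa> = subtopology (C_kappa_top \<kappa>) (UC_kappa \<kappa>)"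

lemma knorm_diff_finite:
  assumes "u \<in> C_kappa \<kappa>" "v \<in> C_kappa \<kappa>"
  shows "knorm \<kappa> (\<lambda>x. u x - v x) < \<infinity>"
proof -
  have "knorm \<kappa> (\<lambda>x. u x - v x) \<le> knorm \<kappa> u + knorm \<kappa> v"
    unfolding knorm_def
  proof (rule SUP_least)
    fix x
    have "ennreal \<bar>\<kappa> x * (u x - v x)\<bar> \<le> ennreal (\<bar>\<kappa> x * u x\<bar> + \<bar>\<kappa> x * v x\<bar>)"
      by (intro ennreal_leI) (simp add: right_diff_distrib)
    also have "\<dots> = ennreal \<bar>\<kappa> x * u x\<bar> + ennreal \<bar>\<kappa> x * v x\<bar>"
      by simp
    also have "\<dots> \<le> (SUP x. ennreal \<bar>\<kappa> x * u x\<bar>) + (SUP x. ennreal \<bar>\<kappa> x * v x\<bar>)"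
      by (intro add_mono SUP_upper) auto
    finally show "ennreal \<bar>\<kappa> x * (u x - v x)\<bar> \<le> \<dots>" .
  qed
  also have "\<dots> < \<infinity>"
    using assms by (simp add: C_kappa_def)
  finally show ?thesis .
qed

lemma Metric_space_C_kappa:
  fixes \<kappa> :: "'a::metric_space \<Rightarrow> real"
  assumes pos: "\<And>x. \<kappa> x > 0"
  shows "Metric_space (C_kappa \<kappa>) (kdist \<kappa>)"
proof
  fix u v :: "'a \<Rightarrow> real"
  show "0 \<le> kdist \<kappa> u v" by (simp add: kdist_def)
  show "kdist \<kappa> u v = kdist \<kappa> v u"
    by (simp add: kdist_def knorm_def abs_mult abs_minus_commute)
next
  fix u v assume uv: "u \<in> C_kappa \<kappa>" "v \<in> C_kappa \<kappa>"
  show "kdist \<kappa> u v = 0 \<longleftrightarrow> u = v"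
  proof
    assume "kdist \<kappa> u v = 0"
    then have "knorm \<kappa> (\<lambda>x. u x - v x) = 0"
      using knorm_diff_finite[OF uv] by (auto simp: kdist_def enn2real_eq_0_iff)
    then have *: "ennreal \<bar>\<kappa> x * (u x - v x)\<bar> \<le> 0" for x
      using SUP_upper[of x UNIV "\<lambda>x. ennreal \<bar>\<kappa> x * (u x - v x)\<bar>"] by (simp add: knorm_def)
    have "u x = v x" for x
    proof -
      have "\<kappa> x * (u x - v x) = 0"
        using *[of x] by (simp add: ennreal_eq_0_iff)
      with pos[of x] show ?thesis by simp
    qed
    then show "u = v" by blast
  qed (simp add: kdist_def knorm_def)
next
  fix u v w assume uvw: "u \<in> C_kappa \<kappa>" "v \<in> C_kappa \<kappa>" "w \<in> C_kappa \<kappa>"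
  have "knorm \<kappa> (\<lambda>x. u x - w x) \<le> knorm \<kappa> (\<lambda>x. u x - v x) + knorm \<kappa> (\<lambda>x. v x - w x)"
    unfolding knorm_def
  proof (rule SUP_least)
    fix x
    have "\<kappa> x * (u x - w x) = \<kappa> x * (u x - v x) + \<kappa> x * (v x - w x)"
      by (simp add: algebra_simps)
    then have "ennreal \<bar>\<kappa> x * (u x - w x)\<bar> \<le>
        ennreal (\<bar>\<kappa> x * (u x - v x)\<bar> + \<bar>\<kappa> x * (v x - w x)\<bar>)"
      by (intro ennreal_leI) linarith
    also have "\<dots> = ennreal \<bar>\<kappa> x * (u x - v x)\<bar> + ennreal \<bar>\<kappa> x * (v x - w x)\<bar>"
      by simp
    also have "\<dots> \<le> (SUP x. ennreal \<bar>\<kappa> x * (u x - v x)\<bar>) + (SUP x. ennreal \<bar>\<kappa> x * (v x - w x)\<bar>)"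
      by (intro add_mono SUP_upper) auto
    finally show "ennreal \<bar>\<kappa> x * (u x - w x)\<bar> \<le> \<dots>" .
  qed
  moreover have "knorm \<kappa> (\<lambda>x. u x - v x) < top" "knorm \<kappa> (\<lambda>x. v x - w x) < top"
    using knorm_diff_finite uvw by auto
  ultimately show "kdist \<kappa> u w \<le> kdist \<kappa> u v + kdist \<kappa> v w"
    unfolding kdist_def
    by (subst enn2real_plus[symmetric]) (assumption | rule enn2real_mono | simp)+
qed

section \<open>Feller semigroups\<close>

definition incr_to :: "(nat \<Rightarrow> 'a \<Rightarrow> real) \<Rightarrow> ('a \<Rightarrow> real) \<Rightarrow> bool" where
  "incr_to U u \<longleftrightarrow> (\<forall>n x. U n x \<le> U (Suc n) x) \<and> (\<forall>x. (\<lambda>n. U n x) \<longlonglongrightarrow> u x)"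

text \<open>Operators are total functions on \<^typ>\<open>'a \<Rightarrow> real\<close>; only their restrictions to
  \<^const>\<open>UC_kappa\<close> and to nonnegative times matter. That each of them maps
  \<^const>\<open>UC_kappa\<close> to itself is part of \<^const>\<open>continuous_map\<close>.\<close>

definition feller_semigroup ::
    "('a::metric_space \<Rightarrow> real) \<Rightarrow> (real \<Rightarrow> ('a \<Rightarrow> real) \<Rightarrow> 'a \<Rightarrow> real) \<Rightarrow> bool" where
  "feller_semigroup \<kappa> T \<longleftrightarrow>
    (\<forall>t\<ge>0. continuous_map (UC_kappa_top \<kappa>) (UC_kappa_top \<kappa>) (T t)) \<and>
    (\<forall>u\<in>UC_kappa \<kappa>. T 0 u = u) \<and>
    (\<forall>s\<ge>0. \<forall>t\<ge>0. \<forall>u\<in>UC_kappa \<kappa>. T (s + t) u = T s (T t u)) \<and>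
    (\<forall>t\<ge>0. mono_on (UC_kappa \<kappa>) (T t)) \<and>
    (\<forall>t\<ge>0. \<forall>U u. range U \<subseteq> UC_kappa \<kappa> \<longrightarrow> u \<in> UC_kappa \<kappa> \<longrightarrow> incr_to U u \<longrightarrow>
       incr_to (\<lambda>n. T t (U n)) (T t u))"

definition linear_on_UC ::
    "('a::metric_space \<Rightarrow> real) \<Rightarrow> (('a \<Rightarrow> real) \<Rightarrow> 'a \<Rightarrow> real) \<Rightarrow> bool" where
  "linear_on_UC \<kappa> A \<longleftrightarrow>
    (\<forall>u\<in>UC_kappa \<kappa>. \<forall>v\<in>UC_kappa \<kappa>. \<forall>a b.
       A (\<lambda>x. a * u x + b * v x) = (\<lambda>x. a * A u x + b * A v x))"

definition strongly_continuous_on ::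
    "('a::metric_space \<Rightarrow> real) \<Rightarrow> ('a \<Rightarrow> real) set \<Rightarrow>
     (real \<Rightarrow> ('a \<Rightarrow> real) \<Rightarrow> 'a \<Rightarrow> real) \<Rightarrow> bool" where
  "strongly_continuous_on \<kappa> V T \<longleftrightarrow>
    (\<forall>u\<in>V. continuous_map (top_of_set {0..}) (UC_kappa_top \<kappa>) (\<lambda>t. T t u))"

section \<open>The semigroup envelope\<close>

definition env_step ::
    "'l set \<Rightarrow> ('l \<Rightarrow> real \<Rightarrow> ('a \<Rightarrow> real) \<Rightarrow> 'a \<Rightarrow> real) \<Rightarrow> real \<Rightarrow> ('a \<Rightarrow> real) \<Rightarrow> 'a \<Rightarrow> real"
  where "env_step \<Lambda> S h u = (\<lambda>x. SUP l\<in>\<Lambda>. S l h u x)"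

fun env_list ::
    "'l set \<Rightarrow> ('l \<Rightarrow> real \<Rightarrow> ('a \<Rightarrow> real) \<Rightarrow> 'a \<Rightarrow> real) \<Rightarrow> real list \<Rightarrow> ('a \<Rightarrow> real) \<Rightarrow> 'a \<Rightarrow> real"
  where
    "env_list \<Lambda> S (s # t # ts) u = env_step \<Lambda> S (t - s) (env_list \<Lambda> S (t # ts) u)"
  | "env_list \<Lambda> S _ u = u"

definition env_part ::
    "'l set \<Rightarrow> ('l \<Rightarrow> real \<Rightarrow> ('a \<Rightarrow> real) \<Rightarrow> 'a \<Rightarrow> real) \<Rightarrow> real set \<Rightarrow> ('a \<Rightarrow> real) \<Rightarrow> 'a \<Rightarrow> real"
  where "env_part \<Lambda> S \<pi> = env_list \<Lambda> S (sorted_list_of_set \<pi>)"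

definition partitions :: "real \<Rightarrow> real set set" where
  "partitions t = {\<pi>. finite \<pi> \<and> \<pi> \<subseteq> {0..} \<and> 0 \<in> \<pi> \<and> Max \<pi> = t}"

text \<open>Under the standing assumptions the real suprema below and in \<^const>\<open>env_step\<close> range over
  nonempty bounded sets for arguments in \<^const>\<open>UC_kappa\<close> and nonnegative times.\<close>

definition envelope ::
    "'l set \<Rightarrow> ('l \<Rightarrow> real \<Rightarrow> ('a \<Rightarrow> real) \<Rightarrow> 'a \<Rightarrow> real) \<Rightarrow> real \<Rightarrow> ('a \<Rightarrow> real) \<Rightarrow> 'a \<Rightarrow> real"
  where "envelope \<Lambda> S t u = (\<lambda>x. SUP \<pi>\<in>partitions t. env_part \<Lambda> S \<pi> u x)"

definition D_Lambda ::
    "('a::metric_space \<Rightarrow> real) \<Rightarrow> 'l set \<Rightarrow> ('l \<Rightarrow> real \<Rightarrow> ('a \<Rightarrow> real) \<Rightarrow> 'a \<Rightarrow> real) \<Rightarrow>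
     ('a \<Rightarrow> real) set" where
  "D_Lambda \<kappa> \<Lambda> S = {u \<in> UC_kappa \<kappa>. \<exists>L\<ge>0. \<exists>h\<^sub>u>0. \<forall>h\<in>{0..<h\<^sub>u}.
     (SUP l\<in>\<Lambda>. knorm \<kappa> (\<lambda>x. S l h u x - u x)) \<le> ennreal (L * h)}"

end

theory Submission
  imports Defs
begin

text \<open>The proof compares the envelope at two times \<open>s \<le> t\<close> directly, partition by partition.

  Three facts carry it. The semigroup law gives \<open>S\<^sub>\<lambda>(p + q)u = S\<^sub>\<lambda>(p) S\<^sub>\<lambda>(q)u \<le> E\<^sub>p E\<^sub>q u\<close>, where \<open>E\<^sub>h\<close>
  is the supremum over \<open>\<lambda>\<close> of \<open>S\<^sub>\<lambda>(h)\<close>, so the composition along a partition can only grow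
  when \<open>s\<close> is inserted as a further point (\<open>subdivision_refinement\<close>). The composition along a
  partition \<open>\<pi>\<close> of \<open>[0, t]\<close> containing \<open>s\<close> is \<open>E\<^sub>\<rho> E\<^sub>\<sigma>\<close> with \<open>\<rho>\<close> a partition of \<open>[0, s]\<close> and \<open>\<sigma>\<close> one of
  \<open>[s, t]\<close>, and \<open>E\<^sub>\<rho>\<close> is Lipschitz with constant \<open>exp (\<alpha> s)\<close> for the weighted norm. Finally, for \<open>u\<close>
  in the domain \<open>D_Lambda\<close> and \<open>t - s\<close> small, telescoping over the steps of \<open>\<sigma>\<close> shows that
  \<open>E\<^sub>\<sigma> u\<close> differs from \<open>u\<close> by at most \<open>exp (\<bar>\<alpha>\<bar> (t - s)) L (t - s)\<close>, whatever \<open>\<sigma>\<close> is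
  (\<open>env_list_drift\<close>).

  Together, \<open>E\<^sub>\<pi> u\<close> and \<open>E\<^sub>\<rho> u\<close> are within \<open>exp (\<bar>\<alpha>\<bar> t) L (t - s)\<close> of each other. Every \<open>\<pi>\<close> is dominated by
  one containing \<open>s\<close>, and every \<open>\<rho>\<close> arises from \<open>\<pi> = \<rho> \<union> {t}\<close>, so the same bound holds between
  the two suprema (\<open>envelope_modulus\<close>). This is local Lipschitz continuity in time on \<open>D_Lambda\<close>.
  Since the envelope at time \<open>t\<close> is again Lipschitz with constant \<open>exp (\<alpha> t)\<close>, which is locally
  bounded in \<open>t\<close>, continuity passes to the closure.

  It also has to be known that the envelope stays in \<open>UC_kappa\<close>. Monotonicity, a Lipschitz bound
  for the weighted norm and the preservation of Lipschitz constants and sup bounds are combined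
  in the predicate \<open>tame\<close>. It holds for the given linear operators, is stable under composition
  and under suprema of families, and implies invariance of \<open>UC_kappa\<close>.\<close>

section \<open>Bounded Lipschitz functions\<close>

lemma Lip_bI: "L-lipschitz_on UNIV u \<Longrightarrow> (\<And>x. \<bar>u x\<bar> \<le> B) \<Longrightarrow> u \<in> Lip_b"
  by (auto simp: Lip_b_def bounded_iff)

lemma Lip_bE:
  assumes "u \<in> Lip_b"
  obtains L B where "L-lipschitz_on UNIV u" "\<And>x. \<bar>u x\<bar> \<le> B"
  using assms by (auto simp: Lip_b_def bounded_iff)

lemma const_in_Lip_b: "(\<lambda>_. c) \<in> Lip_b"
  by (rule Lip_bI[of 0 _ "\<bar>c\<bar>"]) (auto simp: lipschitz_on_def)

lemma Lip_b_linear_combination: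
  assumes "u \<in> Lip_b" "v \<in> Lip_b"
  shows "(\<lambda>x. a * u x + b * v x) \<in> Lip_b"
proof -
  obtain L B where L: "L-lipschitz_on UNIV u" "\<And>x. \<bar>u x\<bar> \<le> B"
    using assms Lip_bE by blast
  obtain L' B' where L': "L'-lipschitz_on UNIV v" "\<And>x. \<bar>v x\<bar> \<le> B'"
    using assms Lip_bE by blast
  show ?thesis
  proof (rule Lip_bI)
    show "(\<bar>a\<bar> * L + \<bar>b\<bar> * L')-lipschitz_on UNIV (\<lambda>x. a * u x + b * v x)"
      by (intro lipschitz_intros L L')
    show "\<bar>a * u x + b * v x\<bar> \<le> \<bar>a\<bar> * B + \<bar>b\<bar> * B'" for x
      using L(2)[of x] L'(2)[of x]
      by (intro order_trans[OF abs_triangle_ineq] add_mono) (auto simp: abs_mult mult_left_mono)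
  qed
qed

text \<open>The infimum in \<open>lip_norm\<close> is attained: a Lipschitz estimate with every constant above \<open>L\<close> is one
  with \<open>L\<close>.\<close>

lemma lipschitz_on_iff_lip_norm_le:
  assumes "0 \<le> L"
  shows "L-lipschitz_on UNIV u \<longleftrightarrow> lip_norm u \<le> ennreal L"
proof
  assume "L-lipschitz_on UNIV u"
  then show "lip_norm u \<le> ennreal L"
    unfolding lip_norm_def by (intro Inf_lower) (auto simp: lipschitz_on_def dist_real_def)
next
  assume le: "lip_norm u \<le> ennreal L"
  have "\<bar>u x - u y\<bar> \<le> L * dist x y" for x y
  proof (rule field_le_epsilon)
    fix e :: real assume e: "0 < e"
    \<comment> \<open>The slack depends on the pair of points, so that it contributes at most \<open>e\<close>; the summand 1
      covers the case of equal points.\<close>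
    define r where "r = L + e / (dist x y + 1)"
    have "0 < e / (dist x y + 1)"
      using e by (simp add: add_nonneg_pos)
    then have "L < r" "0 \<le> r"
      using assms by (auto simp: r_def)
    then have "lip_norm u < ennreal r"
      using le assms by (meson ennreal_less_iff le_less_trans)
    then obtain L' where L': "0 \<le> L'" "\<And>x y. \<bar>u x - u y\<bar> \<le> L' * dist x y" "ennreal L' < ennreal r"
      unfolding lip_norm_def Inf_less_iff by auto
    have "\<bar>u x - u y\<bar> \<le> L' * dist x y"
      by (rule L'(2))
    also have "\<dots> \<le> r * dist x y"
      using L' \<open>0 \<le> r\<close> by (intro mult_right_mono) (auto simp: ennreal_less_iff)
    also have "\<dots> = L * dist x y + e * (dist x y / (dist x y + 1))"
      by (simp add: r_def algebra_simps)
    also have "e * (dist x y / (dist x y + 1)) \<le> e"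
      using e by (intro mult_left_le) (auto simp: divide_le_eq_1 add_nonneg_pos)
    finally show "\<bar>u x - u y\<bar> \<le> L * dist x y + e"
      by simp
  qed
  then show "L-lipschitz_on UNIV u"
    using assms by (auto simp: lipschitz_on_def dist_real_def)
qed

section \<open>Weighted approximation by bounded Lipschitz functions\<close>

text \<open>Weighted distance at most \<open>c\<close>, as a pointwise condition on real numbers. It avoids the
  extended-real norm and the truncation in \<open>kdist\<close>, and it can be checked under a supremum.\<close>

definition kclose :: "('a \<Rightarrow> real) \<Rightarrow> real \<Rightarrow> ('a \<Rightarrow> real) \<Rightarrow> ('a \<Rightarrow> real) \<Rightarrow> bool" where
  "kclose \<kappa> c u v \<longleftrightarrow> (\<forall>x. \<kappa> x * \<bar>u x - v x\<bar> \<le> c)"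

lemma kclose_sym: "kclose \<kappa> c u v \<longleftrightarrow> kclose \<kappa> c v u"
  by (simp add: kclose_def abs_minus_commute)

locale weight =
  fixes \<kappa> :: "'a::metric_space \<Rightarrow> real"
  assumes pos: "\<And>x. \<kappa> x > 0"
    and cont: "continuous_on UNIV \<kappa>"
    and bdd: "bounded (range \<kappa>)"
begin

sublocale M: Metric_space "C_kappa \<kappa>" "kdist \<kappa>"
  by (rule Metric_space_C_kappa[OF pos])

lemma knorm_le_iff: "0 \<le> c \<Longrightarrow> knorm \<kappa> u \<le> ennreal c \<longleftrightarrow> (\<forall>x. \<kappa> x * \<bar>u x\<bar> \<le> c)"
  using pos by (simp add: knorm_def SUP_le_iff ennreal_le_iff abs_mult abs_of_pos)

lemma knorm_diff_le_iff: "0 \<le> c \<Longrightarrow> knorm \<kappa> (\<lambda>x. u x - v x) \<le> ennreal c \<longleftrightarrow> kclose \<kappa> c u v"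
  by (simp add: knorm_le_iff kclose_def)

lemma knorm_finite_iff: "knorm \<kappa> u < \<infinity> \<longleftrightarrow> (\<exists>c\<ge>0. \<forall>x. \<kappa> x * \<bar>u x\<bar> \<le> c)"
proof
  assume "knorm \<kappa> u < \<infinity>"
  then obtain c where "0 \<le> c" "knorm \<kappa> u = ennreal c"
    by (cases "knorm \<kappa> u" rule: ennreal_cases) auto
  then show "\<exists>c\<ge>0. \<forall>x. \<kappa> x * \<bar>u x\<bar> \<le> c"
    using knorm_le_iff[of c u] by auto
next
  assume "\<exists>c\<ge>0. \<forall>x. \<kappa> x * \<bar>u x\<bar> \<le> c"
  then obtain c where "0 \<le> c" "knorm \<kappa> u \<le> ennreal c"
    using knorm_le_iff by blast
  then show "knorm \<kappa> u < \<infinity>"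
    using ennreal_less_top le_less_trans unfolding infinity_ennreal_def by blast
qed

lemma kclose_nonneg: "kclose \<kappa> c u v \<Longrightarrow> 0 \<le> c"
  using pos order_trans[OF mult_nonneg_nonneg[OF less_imp_le[OF pos] abs_ge_zero]]
  unfolding kclose_def by blast

lemma kclose_refl: "kclose \<kappa> 0 u u"
  by (simp add: kclose_def)

lemma kclose_mono: "kclose \<kappa> c u v \<Longrightarrow> c \<le> d \<Longrightarrow> kclose \<kappa> d u v"
  unfolding kclose_def by (meson order_trans)

lemma kclose_trans:
  assumes "kclose \<kappa> c u v" "kclose \<kappa> d v w"
  shows "kclose \<kappa> (c + d) u w"
  unfolding kclose_def
proof
  fix x
  have "\<kappa> x * \<bar>u x - w x\<bar> \<le> \<kappa> x * (\<bar>u x - v x\<bar> + \<bar>v x - w x\<bar>)"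
    using pos[of x] by (intro mult_left_mono) auto
  also have "\<dots> \<le> c + d"
    using assms by (simp add: kclose_def distrib_left add_mono)
  finally show "\<kappa> x * \<bar>u x - w x\<bar> \<le> c + d" .
qed

text \<open>In this form the weight acts as the error function \<open>c / \<kappa>\<close>, which is added on one side of an
  inequality between functions; suprema respect such inequalities.\<close>

lemma kclose_iff_le: "kclose \<kappa> c u v \<longleftrightarrow> (\<forall>x. u x \<le> v x + c / \<kappa> x) \<and> (\<forall>x. v x \<le> u x + c / \<kappa> x)"
proof -
  have "\<kappa> x * \<bar>u x - v x\<bar> \<le> c \<longleftrightarrow> u x \<le> v x + c / \<kappa> x \<and> v x \<le> u x + c / \<kappa> x" for x
  proof -
    have "\<kappa> x * \<bar>u x - v x\<bar> \<le> c \<longleftrightarrow> \<bar>u x - v x\<bar> \<le> c / \<kappa> x"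
      using pos[of x] by (simp add: pos_le_divide_eq mult.commute)
    then show ?thesis by linarith
  qed
  then show ?thesis by (auto simp: kclose_def)
qed

lemma kclose_linear_combination:
  assumes "kclose \<kappa> c u u'" "kclose \<kappa> d v v'"
  shows "kclose \<kappa> (\<bar>a\<bar> * c + \<bar>b\<bar> * d) (\<lambda>x. a * u x + b * v x) (\<lambda>x. a * u' x + b * v' x)"
  unfolding kclose_def
proof
  fix x
  have "(a * u x + b * v x) - (a * u' x + b * v' x) = a * (u x - u' x) + b * (v x - v' x)"
    by (simp add: algebra_simps)
  then have "\<bar>(a * u x + b * v x) - (a * u' x + b * v' x)\<bar>
      \<le> \<bar>a\<bar> * \<bar>u x - u' x\<bar> + \<bar>b\<bar> * \<bar>v x - v' x\<bar>"
    using abs_triangle_ineq[of "a * (u x - u' x)" "b * (v x - v' x)"] by (simp add: abs_mult)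
  then have "\<kappa> x * \<bar>(a * u x + b * v x) - (a * u' x + b * v' x)\<bar>
      \<le> \<kappa> x * (\<bar>a\<bar> * \<bar>u x - u' x\<bar> + \<bar>b\<bar> * \<bar>v x - v' x\<bar>)"
    using pos[of x] by (intro mult_left_mono) auto
  also have "\<dots> = \<bar>a\<bar> * (\<kappa> x * \<bar>u x - u' x\<bar>) + \<bar>b\<bar> * (\<kappa> x * \<bar>v x - v' x\<bar>)"
    by (simp add: algebra_simps)
  also have "\<dots> \<le> \<bar>a\<bar> * c + \<bar>b\<bar> * d"
    using assms by (intro add_mono mult_left_mono) (auto simp: kclose_def)
  finally show "\<kappa> x * \<bar>(a * u x + b * v x) - (a * u' x + b * v' x)\<bar> \<le> \<bar>a\<bar> * c + \<bar>b\<bar> * d" .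
qed

lemma kdist_le_iff:
  assumes "u \<in> C_kappa \<kappa>" "v \<in> C_kappa \<kappa>" "0 \<le> c"
  shows "kdist \<kappa> u v \<le> c \<longleftrightarrow> kclose \<kappa> c u v"
proof -
  have "kdist \<kappa> u v \<le> c \<longleftrightarrow> knorm \<kappa> (\<lambda>x. u x - v x) \<le> ennreal c"
    unfolding kdist_def using knorm_diff_finite[OF assms(1,2)] assms(3)
    by (auto intro: enn2real_leI dest!: enn2real_le)
  then show ?thesis
    using knorm_diff_le_iff[OF assms(3)] by simp
qed

lemma mcball_iff:
  assumes "u \<in> C_kappa \<kappa>" "v \<in> C_kappa \<kappa>" "0 < c"
  shows "v \<in> M.mcball u c \<longleftrightarrow> kclose \<kappa> c u v"
  using assms by (simp add: kdist_le_iff)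

lemma Lip_b_subset_C_kappa: "Lip_b \<subseteq> C_kappa \<kappa>"
proof
  fix u :: "'a \<Rightarrow> real" assume "u \<in> Lip_b"
  then obtain L B where L: "L-lipschitz_on UNIV u" and B: "\<And>x. \<bar>u x\<bar> \<le> B"
    using Lip_bE by blast
  obtain K where K: "\<And>x. \<kappa> x \<le> K"
    using bdd unfolding bounded_iff real_norm_def by (meson abs_le_D1 rangeI)
  have "\<kappa> x * \<bar>u x\<bar> \<le> K * B" for x
    using K[of x] B[of x] pos[of x] by (intro mult_mono) auto
  moreover from this[of undefined] have "0 \<le> K * B"
    using order_trans[OF mult_nonneg_nonneg[OF less_imp_le[OF pos] abs_ge_zero]] by blast
  ultimately show "u \<in> C_kappa \<kappa>"
    using lipschitz_on_continuous_on[OF L] knorm_finite_iff[of u] by (auto simp: C_kappa_def)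
qed

text \<open>Although \<open>\<kappa>\<close> may tend to 0, so that weighted approximation does not bound the plain
  differences uniformly, the products \<open>\<kappa> v\<^sub>n\<close> converge uniformly to \<open>\<kappa> u\<close>; dividing the continuous
  limit by the positive continuous weight gives continuity of \<open>u\<close>.\<close>

lemma C_kappa_closed:
  assumes approx: "\<And>\<epsilon>. 0 < \<epsilon> \<Longrightarrow> \<exists>v\<in>C_kappa \<kappa>. kclose \<kappa> \<epsilon> u v"
  shows "u \<in> C_kappa \<kappa>"
proof -
  have "\<exists>v. v \<in> C_kappa \<kappa> \<and> kclose \<kappa> (inverse (Suc n)) u v" for n
    using approx[of "inverse (Suc n)"] by auto
  then obtain v where v: "\<And>n. v n \<in> C_kappa \<kappa>" "\<And>n. kclose \<kappa> (inverse (Suc n)) u (v n)"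
    by metis
  have "uniform_limit UNIV (\<lambda>n x. \<kappa> x * v n x) (\<lambda>x. \<kappa> x * u x) sequentially"
  proof (rule uniform_limitI)
    fix e :: real assume "0 < e"
    then obtain N where N: "inverse (real (Suc N)) < e"
      using reals_Archimedean by blast
    show "\<forall>\<^sub>F n in sequentially. \<forall>x\<in>UNIV. dist (\<kappa> x * v n x) (\<kappa> x * u x) < e"
      unfolding eventually_sequentially
    proof (intro exI allI impI ballI)
      fix n x assume "N \<le> n"
      have "dist (\<kappa> x * v n x) (\<kappa> x * u x) = \<kappa> x * \<bar>u x - v n x\<bar>"
        using pos[of x] by (simp add: dist_real_def abs_minus_commute abs_mult flip: right_diff_distrib)
      also have "\<dots> \<le> inverse (Suc n)"
        using v(2) by (auto simp: kclose_def)
      also have "\<dots> \<le> inverse (Suc N)"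
        using \<open>N \<le> n\<close> by (simp add: field_simps)
      also note N
      finally show "dist (\<kappa> x * v n x) (\<kappa> x * u x) < e" .
    qed
  qed
  then have "continuous_on UNIV (\<lambda>x. \<kappa> x * u x)"
    using v(1) cont
    by (intro uniform_limit_theorem[rotated]) (auto simp: C_kappa_def intro!: always_eventually continuous_on_mult)
  then have "continuous_on UNIV (\<lambda>x. \<kappa> x * u x / \<kappa> x)"
    using cont pos by (intro continuous_on_divide) (auto simp: less_imp_neq[symmetric])
  moreover have "(\<lambda>x. \<kappa> x * u x / \<kappa> x) = u"
    using pos by (auto simp: less_imp_neq[symmetric])
  ultimately have "continuous_on UNIV u"
    by (simp only:)
  moreover obtain c where c: "0 \<le> c" "\<And>x. \<kappa> x * \<bar>v 0 x\<bar> \<le> c"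
    using v(1)[of 0] knorm_finite_iff[of "v 0"] by (auto simp: C_kappa_def)
  then have "kclose \<kappa> (1 + c) u (\<lambda>_. 0)"
    using kclose_trans[OF v(2)[of 0], of c "\<lambda>_. 0"] by (simp add: kclose_def)
  then have "knorm \<kappa> u < \<infinity>"
    using c(1) by (subst knorm_finite_iff) (auto simp: kclose_def intro!: exI[of _ "1 + c"])
  ultimately show ?thesis
    by (simp add: C_kappa_def)
qed

text \<open>Continuity of \<open>u\<close> is a consequence of the approximation property. Membership of a supremum
  in \<open>UC_kappa\<close> can therefore be shown by approximation alone, even though suprema of continuous
  functions need not be continuous.\<close>

lemma UC_kappa_iff: "u \<in> UC_kappa \<kappa> \<longleftrightarrow> (\<forall>\<epsilon>>0. \<exists>v\<in>Lip_b. kclose \<kappa> \<epsilon> u v)"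
proof -
  have "u \<in> UC_kappa \<kappa> \<longleftrightarrow> u \<in> C_kappa \<kappa> \<and> (\<forall>\<epsilon>>0. \<exists>v\<in>Lip_b. v \<in> M.mcball u \<epsilon>)"
    by (simp add: UC_kappa_def C_kappa_top_def M.metric_closure_of_alt)
  also have "\<dots> \<longleftrightarrow> u \<in> C_kappa \<kappa> \<and> (\<forall>\<epsilon>>0. \<exists>v\<in>Lip_b. kclose \<kappa> \<epsilon> u v)"
    using mcball_iff[OF _ subsetD[OF Lip_b_subset_C_kappa]] by (simp cong: conj_cong)
  also have "\<dots> \<longleftrightarrow> (\<forall>\<epsilon>>0. \<exists>v\<in>Lip_b. kclose \<kappa> \<epsilon> u v)"
    using C_kappa_closed Lip_b_subset_C_kappa by blast
  finally show ?thesis .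
qed

lemma UC_kappa_subset_C_kappa: "UC_kappa \<kappa> \<subseteq> C_kappa \<kappa>"
  using C_kappa_closed Lip_b_subset_C_kappa UC_kappa_iff by blast

lemma Lip_b_subset_UC_kappa: "Lip_b \<subseteq> UC_kappa \<kappa>"
  unfolding UC_kappa_iff subset_iff using kclose_mono[OF kclose_refl] less_imp_le by blast

lemma const_in_UC_kappa: "(\<lambda>_. c) \<in> UC_kappa \<kappa>"
  using const_in_Lip_b Lip_b_subset_UC_kappa by blast

lemma UC_kappa_linear_combination:
  assumes "u \<in> UC_kappa \<kappa>" "v \<in> UC_kappa \<kappa>"
  shows "(\<lambda>x. a * u x + b * v x) \<in> UC_kappa \<kappa>"
  unfolding UC_kappa_iff
proof (intro allI impI)
  fix \<epsilon> :: real assume \<epsilon>: "0 < \<epsilon>"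
  define \<delta> where "\<delta> = \<epsilon> / (\<bar>a\<bar> + \<bar>b\<bar> + 1)"
  have "0 < \<delta>"
    using \<epsilon> by (simp add: \<delta>_def add_nonneg_pos)
  then obtain u' v' where *: "u' \<in> Lip_b" "kclose \<kappa> \<delta> u u'" "v' \<in> Lip_b" "kclose \<kappa> \<delta> v v'"
    using assms UC_kappa_iff by metis
  have "(\<bar>a\<bar> + \<bar>b\<bar>) * \<delta> \<le> (\<bar>a\<bar> + \<bar>b\<bar> + 1) * \<delta>"
    using \<open>0 < \<delta>\<close> by (intro mult_right_mono) auto
  also have "\<dots> = \<epsilon>"
    by (simp add: \<delta>_def add_nonneg_pos less_imp_neq[symmetric])
  finally have "\<bar>a\<bar> * \<delta> + \<bar>b\<bar> * \<delta> \<le> \<epsilon>"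
    by (simp add: distrib_right)
  then have "kclose \<kappa> \<epsilon> (\<lambda>x. a * u x + b * v x) (\<lambda>x. a * u' x + b * v' x)"
    using kclose_mono[OF kclose_linear_combination[OF *(2,4), of a b]] by blast
  with Lip_b_linear_combination[OF *(1,3)] show "\<exists>w\<in>Lip_b. kclose \<kappa> \<epsilon> (\<lambda>x. a * u x + b * v x) w"
    by blast
qed

lemma topspace_UC_kappa_top: "topspace (UC_kappa_top \<kappa>) = UC_kappa \<kappa>"
  using UC_kappa_subset_C_kappa by (auto simp: UC_kappa_top_def C_kappa_top_def)

lemma closure_UC_kappa_iff:
  assumes "D \<subseteq> UC_kappa \<kappa>"
  shows "u \<in> UC_kappa_top \<kappa> closure_of D \<longleftrightarrow> u \<in> UC_kappa \<kappa> \<and> (\<forall>\<epsilon>>0. \<exists>v\<in>D. kclose \<kappa> \<epsilon> u v)"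
proof -
  have "UC_kappa \<kappa> \<inter> D = D"
    using assms by blast
  then have "u \<in> UC_kappa_top \<kappa> closure_of D
      \<longleftrightarrow> u \<in> UC_kappa \<kappa> \<and> u \<in> C_kappa \<kappa> \<and> (\<forall>\<epsilon>>0. \<exists>v\<in>D. v \<in> M.mcball u \<epsilon>)"
    by (simp add: UC_kappa_top_def closure_of_subtopology C_kappa_top_def M.metric_closure_of_alt)
  also have "\<dots> \<longleftrightarrow> u \<in> UC_kappa \<kappa> \<and> (\<forall>\<epsilon>>0. \<exists>v\<in>D. kclose \<kappa> \<epsilon> u v)"
    using mcball_iff[OF subsetD[OF UC_kappa_subset_C_kappa] subsetD[OF subset_trans[OF assms UC_kappa_subset_C_kappa]]]
      UC_kappa_subset_C_kappa by (auto simp: subset_iff cong: conj_cong)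
  finally show ?thesis .
qed

lemma continuous_map_UC_kappaD:
  assumes F: "continuous_map (UC_kappa_top \<kappa>) (UC_kappa_top \<kappa>) F"
    and u: "u \<in> UC_kappa \<kappa>" and \<epsilon>: "0 < \<epsilon>"
  obtains \<delta> where "0 < \<delta>"
    "\<And>v. v \<in> UC_kappa \<kappa> \<Longrightarrow> kclose \<kappa> \<delta> u v \<Longrightarrow> kclose \<kappa> \<epsilon> (F u) (F v)"
proof -
  have maps: "F v \<in> UC_kappa \<kappa>" if "v \<in> UC_kappa \<kappa>" for v
    using continuous_map_image_subset_topspace[OF F] that by (auto simp: topspace_UC_kappa_top)
  have "continuous_map (UC_kappa_top \<kappa>) M.mtopology F"
    using F by (simp add: UC_kappa_top_def continuous_map_in_subtopology C_kappa_top_def)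
  then obtain U where U: "openin (UC_kappa_top \<kappa>) U" "u \<in> U" "\<And>v. v \<in> U \<Longrightarrow> F v \<in> M.mball (F u) \<epsilon>"
    using u \<epsilon> unfolding M.continuous_map_to_metric topspace_UC_kappa_top by meson
  then obtain V where V: "openin M.mtopology V" "U = V \<inter> UC_kappa \<kappa>"
    by (auto simp: UC_kappa_top_def openin_subtopology C_kappa_top_def)
  then obtain r where r: "0 < r" "M.mball u r \<subseteq> V"
    using U(2) by (auto simp: M.openin_mtopology)
  show thesis
  proof (rule that[of "r / 2"])
    show "0 < r / 2" using r by simp
    fix v assume v: "v \<in> UC_kappa \<kappa>" "kclose \<kappa> (r / 2) u v"
    have "kdist \<kappa> u v \<le> r / 2"
      using v u r UC_kappa_subset_C_kappa by (subst kdist_le_iff) auto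
    then have "v \<in> M.mball u r"
      using u v(1) r(1) UC_kappa_subset_C_kappa by auto
    then have "F v \<in> M.mball (F u) \<epsilon>"
      using r V U v by blast
    then show "kclose \<kappa> \<epsilon> (F u) (F v)"
      using kdist_le_iff[of "F u" "F v" \<epsilon>] \<epsilon> by simp
  qed
qed

lemma continuous_map_UC_kappaI:
  fixes f :: "real \<Rightarrow> 'a \<Rightarrow> real"
  assumes UC: "\<And>t. t \<in> A \<Longrightarrow> f t \<in> UC_kappa \<kappa>"
    and cont: "\<And>t \<epsilon>. t \<in> A \<Longrightarrow> 0 < \<epsilon> \<Longrightarrow>
      \<exists>\<delta>>0. \<forall>s\<in>A. \<bar>s - t\<bar> < \<delta> \<longrightarrow> kclose \<kappa> \<epsilon> (f t) (f s)"
  shows "continuous_map (top_of_set A) (UC_kappa_top \<kappa>) f"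
proof -
  have "continuous_map (top_of_set A) M.mtopology f"
    unfolding M.continuous_map_to_metric
  proof (intro ballI allI impI)
    fix t and \<epsilon> :: real assume "t \<in> topspace (top_of_set A)" and \<epsilon>: "0 < \<epsilon>"
    then have t: "t \<in> A" by simp
    obtain \<delta> where \<delta>: "0 < \<delta>" "\<And>s. s \<in> A \<Longrightarrow> \<bar>s - t\<bar> < \<delta> \<Longrightarrow> kclose \<kappa> (\<epsilon> / 2) (f t) (f s)"
      using cont[OF t, of "\<epsilon> / 2"] \<epsilon> by auto
    show "\<exists>U. openin (top_of_set A) U \<and> t \<in> U \<and> (\<forall>s\<in>U. f s \<in> M.mball (f t) \<epsilon>)"
    proof (intro exI conjI ballI)
      show "openin (top_of_set A) (A \<inter> ball t \<delta>)" by (simp add: openin_open_Int)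
      show "t \<in> A \<inter> ball t \<delta>" using t \<delta> by simp
      fix s assume s: "s \<in> A \<inter> ball t \<delta>"
      then have "kdist \<kappa> (f t) (f s) \<le> \<epsilon> / 2"
        using \<delta>(2)[of s] UC t \<epsilon> UC_kappa_subset_C_kappa
        by (subst kdist_le_iff) (auto simp: dist_real_def abs_minus_commute)
      then show "f s \<in> M.mball (f t) \<epsilon>"
        using \<epsilon> UC t s UC_kappa_subset_C_kappa by auto
    qed
  qed
  then show ?thesis
    using UC by (auto simp: UC_kappa_top_def continuous_map_in_subtopology C_kappa_top_def)
qed

section \<open>Monotone operators with a weighted and an unweighted Lipschitz bound\<close>

text \<open>The properties of the linear operators \<open>S\<^sub>\<lambda>(t)\<close> that survive composition and pointwise suprema.
  The last clause, for bounded Lipschitz arguments, is what keeps the values in \<open>UC_kappa\<close>; the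
  separate sup bound \<open>B\<close> is needed because \<open>Lip_b\<close> asks for boundedness without weight.\<close>

definition tame :: "real \<Rightarrow> real \<Rightarrow> (('a \<Rightarrow> real) \<Rightarrow> 'a \<Rightarrow> real) \<Rightarrow> bool" where
  "tame a b F \<longleftrightarrow> mono_on (UC_kappa \<kappa>) F \<and>
    (\<forall>u\<in>UC_kappa \<kappa>. \<forall>v\<in>UC_kappa \<kappa>. \<forall>c. kclose \<kappa> c u v \<longrightarrow> kclose \<kappa> (a * c) (F u) (F v)) \<and>
    (\<forall>u L B. L-lipschitz_on UNIV u \<longrightarrow> (\<forall>x. \<bar>u x\<bar> \<le> B) \<longrightarrow>
       (b * L)-lipschitz_on UNIV (F u) \<and> (\<forall>x. \<bar>F u x\<bar> \<le> B))"

lemma tame_mono: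
  assumes "tame a b F" "u \<in> UC_kappa \<kappa>" "v \<in> UC_kappa \<kappa>" "u \<le> v"
  shows "F u \<le> F v"
  using assms by (auto simp: tame_def mono_on_def)

lemma tame_kclose:
  assumes "tame a b F" "u \<in> UC_kappa \<kappa>" "v \<in> UC_kappa \<kappa>" "kclose \<kappa> c u v"
  shows "kclose \<kappa> (a * c) (F u) (F v)"
  using assms by (auto simp: tame_def)

lemma tame_lipschitz:
  assumes "tame a b F" "L-lipschitz_on UNIV u" "\<And>x. \<bar>u x\<bar> \<le> B"
  shows "(b * L)-lipschitz_on UNIV (F u)" "\<bar>F u x\<bar> \<le> B"
  using assms unfolding tame_def by blast+

lemma tame_nonneg: "tame a b F \<Longrightarrow> 0 \<le> a"
  using kclose_nonneg[OF tame_kclose[OF _ const_in_UC_kappa const_in_UC_kappa kclose_mono[OF kclose_refl]]]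
  by (metis mult.right_neutral zero_le_one)

text \<open>The zero function is bounded by 0, and this bound is preserved.\<close>

lemma tame_zero:
  assumes "tame a b F"
  shows "F (\<lambda>_. 0) = (\<lambda>_. 0)"
proof
  fix x
  show "F (\<lambda>_. 0) x = 0"
    using tame_lipschitz(2)[OF assms, of 0 "\<lambda>_. 0" 0 x] by (simp add: lipschitz_on_def)
qed

text \<open>If \<open>v \<in> Lip_b\<close> approximates \<open>u\<close>, then \<open>F v\<close> is again in \<open>Lip_b\<close> and approximates \<open>F u\<close>, with the
  error multiplied by \<open>a\<close>. Dividing by \<open>a + 1\<close> rather than by \<open>a\<close> includes the case \<open>a = 0\<close>.\<close>

lemma tame_UC_kappa:
  assumes F: "tame a b F" and u: "u \<in> UC_kappa \<kappa>"
  shows "F u \<in> UC_kappa \<kappa>"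
  unfolding UC_kappa_iff
proof (intro allI impI)
  fix \<epsilon> :: real assume \<epsilon>: "0 < \<epsilon>"
  have a: "0 \<le> a" by (rule tame_nonneg[OF F])
  obtain v where v: "v \<in> Lip_b" "kclose \<kappa> (\<epsilon> / (a + 1)) u v"
    using u[unfolded UC_kappa_iff, rule_format, of "\<epsilon> / (a + 1)"] \<epsilon> a by auto
  then obtain L B where lip: "L-lipschitz_on UNIV v" and bnd: "\<And>x. \<bar>v x\<bar> \<le> B"
    using Lip_bE by blast
  have "F v \<in> Lip_b"
    by (rule Lip_bI[OF tame_lipschitz[OF F lip bnd]])
  moreover have "kclose \<kappa> (a * (\<epsilon> / (a + 1))) (F u) (F v)"
    using tame_kclose[OF F u _ v(2)] v(1) Lip_b_subset_UC_kappa by blast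
  then have "kclose \<kappa> \<epsilon> (F u) (F v)"
    by (rule kclose_mono) (use a \<epsilon> in \<open>simp add: field_simps\<close>)
  ultimately show "\<exists>w\<in>Lip_b. kclose \<kappa> \<epsilon> (F u) w" by blast
qed

lemma UC_kappa_bounded:
  assumes "u \<in> UC_kappa \<kappa>"
  obtains c where "kclose \<kappa> c u (\<lambda>_. 0)"
  using assms UC_kappa_subset_C_kappa knorm_finite_iff[of u]
  by (auto simp: C_kappa_def kclose_def)

text \<open>Comparing \<open>F i u\<close> with \<open>F i 0 = 0\<close> bounds all members of the family by the same \<open>a c / \<kappa> x\<close>. This
  is what makes the real suprema below meaningful.\<close>

lemma tame_bdd_above:
  assumes F: "\<And>i. i \<in> I \<Longrightarrow> tame a b (F i)" and u: "u \<in> UC_kappa \<kappa>"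
  shows "bdd_above ((\<lambda>i. F i u x) ` I)"
proof -
  obtain c where c: "kclose \<kappa> c u (\<lambda>_. 0)"
    using UC_kappa_bounded[OF u] .
  show ?thesis
  proof (rule bdd_aboveI2)
    fix i assume i: "i \<in> I"
    show "F i u x \<le> 0 + a * c / \<kappa> x"
      using tame_kclose[OF F[OF i] u const_in_UC_kappa c] tame_zero[OF F[OF i]]
      unfolding kclose_iff_le by metis
  qed
qed

lemma kclose_SUP:
  assumes "I \<noteq> {}" and f: "\<And>x. bdd_above ((\<lambda>i. f i x) ` I)" and g: "\<And>x. bdd_above ((\<lambda>i. g i x) ` I)"
    and fg: "\<And>i. i \<in> I \<Longrightarrow> kclose \<kappa> c (f i) (g i)"
  shows "kclose \<kappa> c (\<lambda>x. SUP i\<in>I. f i x) (\<lambda>x. SUP i\<in>I. g i x)"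
  unfolding kclose_iff_le
proof (intro conjI allI)
  fix x
  show "(SUP i\<in>I. f i x) \<le> (SUP i\<in>I. g i x) + c / \<kappa> x"
  proof (rule cSUP_least[OF \<open>I \<noteq> {}\<close>])
    fix i assume "i \<in> I"
    then show "f i x \<le> (SUP i\<in>I. g i x) + c / \<kappa> x"
      using fg[of i] cSUP_upper[OF \<open>i \<in> I\<close> g, of x] unfolding kclose_iff_le
      by (meson add_right_mono order_trans)
  qed
  show "(SUP i\<in>I. g i x) \<le> (SUP i\<in>I. f i x) + c / \<kappa> x"
  proof (rule cSUP_least[OF \<open>I \<noteq> {}\<close>])
    fix i assume "i \<in> I"
    then show "g i x \<le> (SUP i\<in>I. f i x) + c / \<kappa> x"
      using fg[of i] cSUP_upper[OF \<open>i \<in> I\<close> f, of x] unfolding kclose_iff_le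
      by (meson add_right_mono order_trans)
  qed
qed

text \<open>All three properties are inequalities with the same constants for all members of the family,
  hence they pass to the supremum.\<close>

lemma tame_SUP:
  assumes ne: "I \<noteq> {}" and F: "\<And>i. i \<in> I \<Longrightarrow> tame a b (F i)"
  shows "tame a b (\<lambda>u x. SUP i\<in>I. F i u x)"
  unfolding tame_def
proof (intro conjI ballI allI impI)
  show "mono_on (UC_kappa \<kappa>) (\<lambda>u x. SUP i\<in>I. F i u x)"
  proof (intro mono_onI le_funI)
    fix u v :: "'a \<Rightarrow> real" and x
    assume uv: "u \<in> UC_kappa \<kappa>" "v \<in> UC_kappa \<kappa>" "u \<le> v"
    show "(SUP i\<in>I. F i u x) \<le> (SUP i\<in>I. F i v x)"
      using tame_mono[OF F uv] by (intro cSUP_mono[OF ne tame_bdd_above[OF F uv(2)]]) (auto simp: le_fun_def)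
  qed
next
  fix u v c assume "u \<in> UC_kappa \<kappa>" "v \<in> UC_kappa \<kappa>" "kclose \<kappa> c u v"
  then show "kclose \<kappa> (a * c) (\<lambda>x. SUP i\<in>I. F i u x) (\<lambda>x. SUP i\<in>I. F i v x)"
    by (intro kclose_SUP[OF ne] tame_bdd_above[OF F] tame_kclose[OF F])
next
  fix u :: "'a \<Rightarrow> real" and L B :: real
  assume u: "L-lipschitz_on UNIV u" "\<forall>x. \<bar>u x\<bar> \<le> B"
  have UC: "u \<in> UC_kappa \<kappa>"
    using u Lip_bI Lip_b_subset_UC_kappa by blast
  have bdd: "bdd_above ((\<lambda>i. F i u x) ` I)" for x
    by (rule tame_bdd_above[OF F UC])
  have lip: "(b * L)-lipschitz_on UNIV (F i u)" and bnd: "\<bar>F i u x\<bar> \<le> B" if "i \<in> I" for i x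
    using tame_lipschitz[OF F[OF that] u(1)] u(2) by auto
  obtain j where j: "j \<in> I"
    using ne by blast
  have le: "(SUP i\<in>I. F i u x) \<le> (SUP i\<in>I. F i u y) + b * L * dist x y" for x y
  proof (rule cSUP_least[OF ne])
    fix i assume i: "i \<in> I"
    have "F i u x \<le> F i u y + b * L * dist x y"
      using lipschitz_onD[OF lip[OF i], of x y] by (simp add: dist_real_def)
    also have "F i u y \<le> (SUP i\<in>I. F i u y)"
      by (rule cSUP_upper[OF i bdd])
    finally show "F i u x \<le> (SUP i\<in>I. F i u y) + b * L * dist x y"
      by simp
  qed
  show "(b * L)-lipschitz_on UNIV (\<lambda>x. SUP i\<in>I. F i u x)"
  proof (rule lipschitz_onI)
    show "0 \<le> b * L"
      by (rule lipschitz_on_nonneg[OF lip[OF j]])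
    show "dist (SUP i\<in>I. F i u x) (SUP i\<in>I. F i u y) \<le> b * L * dist x y" for x y
      using le[of x y] le[of y x] by (simp add: dist_real_def dist_commute abs_le_iff)
  qed
  fix x
  have "(SUP i\<in>I. F i u x) \<le> B"
    using bnd by (intro cSUP_least[OF ne]) (simp add: abs_le_iff)
  moreover have "- B \<le> (SUP i\<in>I. F i u x)"
    using cSUP_upper[OF j bdd, of x] bnd[OF j, of x] by linarith
  ultimately show "\<bar>SUP i\<in>I. F i u x\<bar> \<le> B"
    by linarith
qed

lemma tame_id: "tame 1 1 (\<lambda>u. u)"
  by (auto simp: tame_def mono_on_def)

lemma tame_comp:
  assumes F: "tame a b F" and G: "tame a' b' G"
  shows "tame (a * a') (b * b') (\<lambda>u. F (G u))"
  unfolding tame_def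
proof (intro conjI ballI allI impI)
  show "mono_on (UC_kappa \<kappa>) (\<lambda>u. F (G u))"
    by (intro mono_onI tame_mono[OF F] tame_UC_kappa[OF G] tame_mono[OF G])
next
  fix u v c assume "u \<in> UC_kappa \<kappa>" "v \<in> UC_kappa \<kappa>" "kclose \<kappa> c u v"
  then show "kclose \<kappa> (a * a' * c) (F (G u)) (F (G v))"
    using tame_kclose[OF F tame_UC_kappa[OF G] tame_UC_kappa[OF G] tame_kclose[OF G]]
    by (simp add: mult.assoc)
next
  fix u :: "'a \<Rightarrow> real" and L B :: real and x
  assume u: "L-lipschitz_on UNIV u" "\<forall>x. \<bar>u x\<bar> \<le> B"
  then have "(b' * L)-lipschitz_on UNIV (G u)" "\<And>x. \<bar>G u x\<bar> \<le> B"
    using tame_lipschitz[OF G] by auto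
  then show "(b * b' * L)-lipschitz_on UNIV (F (G u))" "\<bar>F (G u) x\<bar> \<le> B"
    using tame_lipschitz[OF F] by (auto simp: mult.assoc)
qed

end

section \<open>Partitions as strictly increasing lists\<close>

text \<open>The partitions of an interval \<open>[s, t]\<close>. Lists make the recursion of \<open>env_list\<close> available, and an
  arbitrary left end point \<open>s\<close> is needed because inductions remove the first point and because a
  partition of \<open>[0, t]\<close> is split at an interior point.\<close>

definition subdivisions :: "real \<Rightarrow> real \<Rightarrow> real list set" where
  "subdivisions s t = {xs. xs \<noteq> [] \<and> sorted_wrt (<) xs \<and> hd xs = s \<and> last xs = t}"

lemma subdivisions_Cons_Cons: "a # b # xs \<in> subdivisions s t \<longleftrightarrow> a = s \<and> a < b \<and> b # xs \<in> subdivisions b t"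
  by (auto simp: subdivisions_def)

lemma subdivisions_single: "[a] \<in> subdivisions s t \<longleftrightarrow> a = s \<and> a = t"
  by (auto simp: subdivisions_def)

lemma subdivisions_le: "xs \<in> subdivisions s t \<Longrightarrow> s \<le> t"
  by (cases xs) (auto simp: subdivisions_def less_imp_le)

lemma sorted_hd_le_last:
  assumes "sorted xs" "x \<in> set xs"
  shows "hd xs \<le> x" "x \<le> last xs"
proof -
  show "hd xs \<le> x"
    using assms by (cases xs) auto
  show "x \<le> last xs"
    using assms by (cases xs rule: rev_cases) (auto simp: sorted_append)
qed

lemma sorted_list_of_set_partitions:
  assumes "0 \<le> t"
  shows "sorted_list_of_set ` partitions t = subdivisions 0 t"
proof (intro equalityI subsetI)
  fix xs assume "xs \<in> sorted_list_of_set ` partitions t"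
  then obtain \<pi> where \<pi>: "finite \<pi>" "\<pi> \<subseteq> {0..}" "0 \<in> \<pi>" "Max \<pi> = t" and xs: "xs = sorted_list_of_set \<pi>"
    by (auto simp: partitions_def)
  have set: "set xs = \<pi>" and sorted: "sorted xs" and strict: "sorted_wrt (<) xs"
    using \<pi> by (auto simp: xs)
  have "xs \<noteq> []" using set \<pi> by auto
  moreover have "hd xs = 0"
    using \<pi>(2,3) set sorted_hd_le_last(1)[OF sorted, of 0] hd_in_set[OF \<open>xs \<noteq> []\<close>]
    by (auto intro: antisym)
  moreover have "last xs = t"
    using sorted_hd_le_last(2)[OF sorted] last_in_set[OF \<open>xs \<noteq> []\<close>] \<pi>(1,4) set
    by (auto intro: Max_eqI[symmetric])
  ultimately show "xs \<in> subdivisions 0 t"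
    using strict by (simp add: subdivisions_def)
next
  fix xs assume xs: "xs \<in> subdivisions 0 t"
  then have *: "xs \<noteq> []" "sorted_wrt (<) xs" "hd xs = 0" "last xs = t"
    by (auto simp: subdivisions_def)
  have "sorted_list_of_set (set xs) = xs"
    using * by (simp add: sorted_list_of_set.idem_if_sorted_distinct strict_sorted_iff)
  moreover have "sorted xs"
    using * by (simp add: strict_sorted_iff)
  then have "set xs \<subseteq> {0..}" "Max (set xs) = t"
    using sorted_hd_le_last[of xs] * by (auto intro!: Max_eqI)
  then have "set xs \<in> partitions t"
    using * hd_in_set[of xs] by (auto simp: partitions_def)
  ultimately show "xs \<in> sorted_list_of_set ` partitions t"
    by (metis imageI)
qed

lemma subdivisions_nonempty: "s \<le> t \<Longrightarrow> subdivisions s t \<noteq> {}"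
  using subdivisions_single[of s s t] subdivisions_Cons_Cons[of s t "[]" s t] subdivisions_single[of t t t]
  by (cases "s = t") auto

lemma envelope_eq_SUP_subdivisions:
  assumes "0 \<le> t"
  shows "envelope \<Lambda> S t u = (\<lambda>x. SUP xs\<in>subdivisions 0 t. env_list \<Lambda> S xs u x)"
  unfolding envelope_def env_part_def sorted_list_of_set_partitions[OF assms, symmetric]
  by (simp add: image_image)

text \<open>The point \<open>t\<close> at which the list is split belongs to both parts, since each factor of the
  composition is given by two neighbouring points.\<close>

lemma env_list_append:
  "env_list \<Lambda> S (xs @ t # ys) u = env_list \<Lambda> S (xs @ [t]) (env_list \<Lambda> S (t # ys) u)"
proof (induction xs rule: induct_list012)
  case (3 a b xs)
  then show ?case by simp
qed auto

section \<open>The one-step operators of a family of linear semigroups\<close>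

locale linear_feller_family = weight \<kappa> for \<kappa> :: "'a::metric_space \<Rightarrow> real" +
  fixes \<Lambda> :: "'l set"
    and S :: "'l \<Rightarrow> real \<Rightarrow> ('a \<Rightarrow> real) \<Rightarrow> 'a \<Rightarrow> real"
    and \<alpha> \<beta> :: real
  assumes ne: "\<Lambda> \<noteq> {}"
    and feller: "\<And>l. l \<in> \<Lambda> \<Longrightarrow> feller_semigroup \<kappa> (S l)"
    and linear: "\<And>l t. l \<in> \<Lambda> \<Longrightarrow> t \<ge> 0 \<Longrightarrow> linear_on_UC \<kappa> (S l t)"
    and one: "\<And>l t. l \<in> \<Lambda> \<Longrightarrow> t \<ge> 0 \<Longrightarrow> S l t (\<lambda>_. 1) = (\<lambda>_. 1)"
    and knorm_growth: "\<And>l t u. l \<in> \<Lambda> \<Longrightarrow> t \<ge> 0 \<Longrightarrow> u \<in> Lip_b \<Longrightarrow>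
           knorm \<kappa> (S l t u) \<le> ennreal (exp (\<alpha> * t)) * knorm \<kappa> u"
    and lip_growth: "\<And>l t u. l \<in> \<Lambda> \<Longrightarrow> t \<ge> 0 \<Longrightarrow> u \<in> Lip_b \<Longrightarrow>
           lip_norm (S l t u) \<le> ennreal (exp (\<beta> * t)) * lip_norm u"
begin

lemma S_linear:
  assumes "l \<in> \<Lambda>" "t \<ge> 0" "u \<in> UC_kappa \<kappa>" "v \<in> UC_kappa \<kappa>"
  shows "S l t (\<lambda>x. a * u x + b * v x) = (\<lambda>x. a * S l t u x + b * S l t v x)"
  using linear[OF assms(1,2)] assms(3,4) by (simp add: linear_on_UC_def)

lemma S_const:
  assumes "l \<in> \<Lambda>" "t \<ge> 0"
  shows "S l t (\<lambda>_. c) = (\<lambda>_. c)"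
  using S_linear[OF assms const_in_UC_kappa[of 1] const_in_UC_kappa[of 1], of c 0] one[OF assms]
  by simp

text \<open>The growth bound in the weighted norm is given on \<open>Lip_b\<close> only. It extends to \<open>UC_kappa\<close>
  because \<open>Lip_b\<close> is dense there and the operator is continuous.\<close>

lemma S_kclose_zero:
  assumes l: "l \<in> \<Lambda>" "t \<ge> 0" and u: "u \<in> UC_kappa \<kappa>" and c: "kclose \<kappa> c u (\<lambda>_. 0)"
  shows "kclose \<kappa> (exp (\<alpha> * t) * c) (S l t u) (\<lambda>_. 0)"
proof -
  have Lip: "kclose \<kappa> (exp (\<alpha> * t) * c) (S l t v) (\<lambda>_. 0)"
    if "v \<in> Lip_b" "kclose \<kappa> c v (\<lambda>_. 0)" for v c
  proof -
    have c: "0 \<le> c" by (rule kclose_nonneg[OF that(2)])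
    have "knorm \<kappa> (S l t v) \<le> ennreal (exp (\<alpha> * t)) * knorm \<kappa> v"
      by (rule knorm_growth[OF l that(1)])
    also have "knorm \<kappa> v \<le> ennreal c"
      using that(2) c by (simp add: knorm_le_iff kclose_def)
    then have "ennreal (exp (\<alpha> * t)) * knorm \<kappa> v \<le> ennreal (exp (\<alpha> * t)) * ennreal c"
      by (rule mult_left_mono) simp
    also have "\<dots> = ennreal (exp (\<alpha> * t) * c)"
      using c by (simp add: ennreal_mult)
    finally show ?thesis
      using c by (simp add: knorm_le_iff kclose_def)
  qed
  have cont: "continuous_map (UC_kappa_top \<kappa>) (UC_kappa_top \<kappa>) (S l t)"
    using feller[OF l(1)] l(2) by (simp add: feller_semigroup_def)
  have approx: "kclose \<kappa> (exp (\<alpha> * t) * c + \<epsilon> * (1 + exp (\<alpha> * t))) (S l t u) (\<lambda>_. 0)" if \<epsilon>: "0 < \<epsilon>" for \<epsilon>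
  proof -
    obtain \<delta> where \<delta>: "0 < \<delta>" "\<And>v. v \<in> UC_kappa \<kappa> \<Longrightarrow> kclose \<kappa> \<delta> u v \<Longrightarrow> kclose \<kappa> \<epsilon> (S l t u) (S l t v)"
      using continuous_map_UC_kappaD[OF cont u \<epsilon>] by blast
    then obtain v where v: "v \<in> Lip_b" "kclose \<kappa> (min \<delta> \<epsilon>) u v"
      using u \<epsilon> unfolding UC_kappa_iff by (meson min_less_iff_conj)
    have "kclose \<kappa> \<delta> u v" "kclose \<kappa> \<epsilon> v u"
      using v(2) kclose_mono[of "min \<delta> \<epsilon>"] by (auto simp: kclose_sym[of \<kappa> \<epsilon>])
    then have "kclose \<kappa> \<epsilon> (S l t u) (S l t v)" "kclose \<kappa> (\<epsilon> + c) v (\<lambda>_. 0)"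
      using \<delta>(2) v(1) Lip_b_subset_UC_kappa kclose_trans[OF _ c] by auto
    then have "kclose \<kappa> (\<epsilon> + exp (\<alpha> * t) * (\<epsilon> + c)) (S l t u) (\<lambda>_. 0)"
      using kclose_trans Lip[OF v(1)] by blast
    then show ?thesis
      by (simp add: algebra_simps)
  qed
  show ?thesis
    unfolding kclose_def
  proof (rule allI, rule field_le_epsilon)
    fix x and e :: real assume e: "0 < e"
    have q: "0 < 1 + exp (\<alpha> * t)"
      by (simp add: add_pos_pos)
    then have "e / (1 + exp (\<alpha> * t)) * (1 + exp (\<alpha> * t)) = e"
      by (intro nonzero_eq_divide_eq[THEN iffD1, OF _ refl]) linarith
    then have "kclose \<kappa> (exp (\<alpha> * t) * c + e) (S l t u) (\<lambda>_. 0)"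
      using approx[OF divide_pos_pos[OF e q]] by (simp only:)
    then show "\<kappa> x * \<bar>S l t u x - 0\<bar> \<le> exp (\<alpha> * t) * c + e"
      unfolding kclose_def by blast
  qed
qed

lemma S_UC_kappa: "l \<in> \<Lambda> \<Longrightarrow> t \<ge> 0 \<Longrightarrow> u \<in> UC_kappa \<kappa> \<Longrightarrow> S l t u \<in> UC_kappa \<kappa>"
  using feller continuous_map_image_subset_topspace[of "UC_kappa_top \<kappa>" "UC_kappa_top \<kappa>" "S l t"]
  by (auto simp: topspace_UC_kappa_top feller_semigroup_def)

text \<open>By linearity the weighted growth bound is a Lipschitz bound, and monotonicity together with
  \<open>S\<^sub>\<lambda>(t) B = B\<close> preserves the bounds \<open>- B \<le> u \<le> B\<close>.\<close>

lemma S_tame: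
  assumes l: "l \<in> \<Lambda>" "t \<ge> 0"
  shows "tame (exp (\<alpha> * t)) (exp (\<beta> * t)) (S l t)"
  unfolding tame_def
proof (intro conjI ballI allI impI)
  show mono: "mono_on (UC_kappa \<kappa>) (S l t)"
    using feller[OF l(1)] l(2) by (simp add: feller_semigroup_def)
next
  fix u v c assume uv: "u \<in> UC_kappa \<kappa>" "v \<in> UC_kappa \<kappa>" "kclose \<kappa> c u v"
  then have "kclose \<kappa> c (\<lambda>x. 1 * u x + (-1) * v x) (\<lambda>_. 0)"
    by (simp add: kclose_def)
  from S_kclose_zero[OF l UC_kappa_linear_combination[OF uv(1,2)] this]
  show "kclose \<kappa> (exp (\<alpha> * t) * c) (S l t u) (S l t v)"
    unfolding S_linear[OF l uv(1,2)] by (simp add: kclose_def)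
next
  fix u :: "'a \<Rightarrow> real" and L B :: real
  assume u: "L-lipschitz_on UNIV u" "\<forall>x. \<bar>u x\<bar> \<le> B"
  then have Lip: "u \<in> Lip_b" using Lip_bI by blast
  have L: "0 \<le> L" by (rule lipschitz_on_nonneg[OF u(1)])
  have "lip_norm (S l t u) \<le> ennreal (exp (\<beta> * t)) * ennreal L"
    using lip_growth[OF l Lip] u(1) L
    by (meson order_trans mult_left_mono lipschitz_on_iff_lip_norm_le zero_le)
  then show "(exp (\<beta> * t) * L)-lipschitz_on UNIV (S l t u)"
    using L by (simp add: lipschitz_on_iff_lip_norm_le ennreal_mult)
  fix x
  have mono: "mono_on (UC_kappa \<kappa>) (S l t)"
    using feller[OF l(1)] l(2) by (simp add: feller_semigroup_def)
  have "u \<in> UC_kappa \<kappa>" using Lip Lip_b_subset_UC_kappa by blast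
  moreover have "u \<le> (\<lambda>_. B)" "(\<lambda>_. - B) \<le> u"
    using u(2) by (auto simp: le_fun_def abs_le_iff minus_le_iff)
  ultimately have "S l t u \<le> S l t (\<lambda>_. B)" "S l t (\<lambda>_. - B) \<le> S l t u"
    by (auto intro!: mono_onD[OF mono] const_in_UC_kappa)
  then show "\<bar>S l t u x\<bar> \<le> B"
    by (auto simp: S_const[OF l] le_fun_def abs_le_iff minus_le_iff)
qed

lemma env_step_tame: "0 \<le> h \<Longrightarrow> tame (exp (\<alpha> * h)) (exp (\<beta> * h)) (env_step \<Lambda> S h)"
  using tame_SUP[OF ne, of "exp (\<alpha> * h)" "exp (\<beta> * h)" "\<lambda>l. S l h"] S_tame
  by (simp add: env_step_def[abs_def])

lemma S_le_env_step:
  assumes "l \<in> \<Lambda>" "0 \<le> h" "u \<in> UC_kappa \<kappa>"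
  shows "S l h u \<le> env_step \<Lambda> S h u"
  unfolding env_step_def le_fun_def
proof
  fix x
  show "S l h u x \<le> (SUP l\<in>\<Lambda>. S l h u x)"
    by (rule cSUP_upper[OF assms(1)], rule tame_bdd_above[OF _ assms(3)], rule S_tame[OF _ assms(2)])
qed

text \<open>Splitting a time step allows \<open>\<lambda>\<close> to be chosen anew in between, hence can only increase the
  supremum.\<close>

lemma env_step_add_le:
  assumes s: "0 \<le> s" and t: "0 \<le> t" and u: "u \<in> UC_kappa \<kappa>"
  shows "env_step \<Lambda> S (s + t) u \<le> env_step \<Lambda> S s (env_step \<Lambda> S t u)"
proof (rule le_funI)
  fix x
  show "env_step \<Lambda> S (s + t) u x \<le> env_step \<Lambda> S s (env_step \<Lambda> S t u) x"
    unfolding env_step_def[of \<Lambda> S "s + t"]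
  proof (rule cSUP_least[OF ne])
    fix l assume l: "l \<in> \<Lambda>"
    have E: "env_step \<Lambda> S t u \<in> UC_kappa \<kappa>"
      by (rule tame_UC_kappa[OF env_step_tame[OF t] u])
    have "S l (s + t) u = S l s (S l t u)"
      using feller[OF l] s t u by (simp add: feller_semigroup_def)
    also have "\<dots> \<le> S l s (env_step \<Lambda> S t u)"
      by (rule tame_mono[OF S_tame[OF l s] S_UC_kappa[OF l t u] E S_le_env_step[OF l t u]])
    also have "\<dots> \<le> env_step \<Lambda> S s (env_step \<Lambda> S t u)"
      by (rule S_le_env_step[OF l s E])
    finally show "S l (s + t) u x \<le> env_step \<Lambda> S s (env_step \<Lambda> S t u) x"
      by (simp add: le_fun_def)
  qed
qed

section \<open>Compositions along partitions\<close>

lemma exp_mult_exp_diff: "exp (c * (b - a)) * exp (c * (d - b)) = exp (c * (d - a))"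
  for a b c d :: real
  by (simp add: mult_exp_exp right_diff_distrib)

lemma env_list_tame: "xs \<in> subdivisions s t \<Longrightarrow> tame (exp (\<alpha> * (t - s))) (exp (\<beta> * (t - s))) (env_list \<Lambda> S xs)"
proof (induction xs arbitrary: s rule: induct_list012)
  case 1
  then show ?case by (simp add: subdivisions_def)
next
  case (2 a)
  then have "env_list \<Lambda> S [a] = (\<lambda>u. u)" "s = t"
    by (auto simp: subdivisions_single)
  then show ?case using tame_id by simp
next
  case (3 a b xs)
  then have *: "a = s" "a < b" "b # xs \<in> subdivisions b t"
    by (auto simp: subdivisions_Cons_Cons)
  have "env_list \<Lambda> S (a # b # xs) = (\<lambda>u. env_step \<Lambda> S (b - a) (env_list \<Lambda> S (b # xs) u))"
    by auto
  moreover have "tame (exp (\<alpha> * (b - a)) * exp (\<alpha> * (t - b))) (exp (\<beta> * (b - a)) * exp (\<beta> * (t - b)))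
      (\<lambda>u. env_step \<Lambda> S (b - a) (env_list \<Lambda> S (b # xs) u))"
    using * "3.IH"(2)[OF *(3)] by (intro tame_comp env_step_tame) auto
  ultimately show ?case
    using *(1) by (simp only: exp_mult_exp_diff)
qed

text \<open>Inserting the point \<open>s\<close> into a partition increases the composition: the step across \<open>s\<close> is split
  by \<open>env_step_add_le\<close>, and the monotone steps before it preserve the inequality. If \<open>s\<close> is already
  a point of the partition, nothing changes.\<close>

lemma subdivision_refinement:
  assumes "xs \<in> subdivisions r t" "r \<le> s" "s \<le> t"
  obtains ys zs where "ys @ [s] \<in> subdivisions r s" "s # zs \<in> subdivisions s t"
    "\<And>u. u \<in> UC_kappa \<kappa> \<Longrightarrow> env_list \<Lambda> S xs u \<le> env_list \<Lambda> S (ys @ s # zs) u"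
proof -
  have "\<exists>ys zs. ys @ [s] \<in> subdivisions r s \<and> s # zs \<in> subdivisions s t \<and>
      (\<forall>u\<in>UC_kappa \<kappa>. env_list \<Lambda> S xs u \<le> env_list \<Lambda> S (ys @ s # zs) u)"
    using assms
  proof (induction xs arbitrary: r rule: induct_list012)
    case 1
    then show ?case by (simp add: subdivisions_def)
  next
    case (2 a)
    then show ?case
      by (intro exI[of _ "[]"]) (auto simp: subdivisions_single)
  next
    case (3 a b xs)
    then have *: "a = r" "a < b" "b # xs \<in> subdivisions b t"
      by (auto simp: subdivisions_Cons_Cons)
    consider "s = a" | "a < s" "s < b" | "b \<le> s"
      using "3.prems" * by linarith
    then show ?case
    proof cases
      case 1
      then show ?thesis
        using "3.prems" * by (intro exI[of _ "[]"] exI[of _ "b # xs"]) (auto simp: subdivisions_single)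
    next
      case 2
      show ?thesis
      proof (intro exI conjI ballI)
        show "[a] @ [s] \<in> subdivisions r s" "s # b # xs \<in> subdivisions s t"
          using * 2 by (auto simp: subdivisions_Cons_Cons subdivisions_single)
        fix u assume "u \<in> UC_kappa \<kappa>"
        then have "env_list \<Lambda> S (b # xs) u \<in> UC_kappa \<kappa>"
          by (rule tame_UC_kappa[OF env_list_tame[OF *(3)]])
        then show "env_list \<Lambda> S (a # b # xs) u \<le> env_list \<Lambda> S ([a] @ s # b # xs) u"
          using env_step_add_le[of "s - a" "b - s"] 2 by simp
      qed
    next
      case 3
      then obtain ys zs where ys: "ys @ [s] \<in> subdivisions b s" and zs: "s # zs \<in> subdivisions s t"
        and le: "\<And>u. u \<in> UC_kappa \<kappa> \<Longrightarrow> env_list \<Lambda> S (b # xs) u \<le> env_list \<Lambda> S (ys @ s # zs) u"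
        using "3.IH"(2)[OF *(3)] "3.prems" by blast
      obtain ys' where ys': "ys @ s # zs = b # ys'"
        using ys by (cases ys) (auto simp: subdivisions_def)
      show ?thesis
      proof (intro exI conjI ballI)
        show "(a # ys) @ [s] \<in> subdivisions r s"
          using ys * by (cases ys) (auto simp: subdivisions_def)
        show "s # zs \<in> subdivisions s t" by (rule zs)
        fix u assume u: "u \<in> UC_kappa \<kappa>"
        have "env_list \<Lambda> S (ys @ s # zs) u \<in> UC_kappa \<kappa>"
          unfolding env_list_append[of \<Lambda> S ys s zs]
          by (rule tame_UC_kappa[OF env_list_tame[OF ys] tame_UC_kappa[OF env_list_tame[OF zs] u]])
        then have "env_step \<Lambda> S (b - a) (env_list \<Lambda> S (b # xs) u)
            \<le> env_step \<Lambda> S (b - a) (env_list \<Lambda> S (ys @ s # zs) u)"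
          using *(2)
          by (intro tame_mono[OF env_step_tame tame_UC_kappa[OF env_list_tame[OF *(3)] u] _ le[OF u]]) auto
        then show "env_list \<Lambda> S (a # b # xs) u \<le> env_list \<Lambda> S ((a # ys) @ s # zs) u"
          by (simp only: append_Cons ys' env_list.simps)
      qed
    qed
  qed
  then show thesis
    using that by blast
qed

lemma envelope_tame:
  assumes "0 \<le> t"
  shows "tame (exp (\<alpha> * t)) (exp (\<beta> * t)) (envelope \<Lambda> S t)"
proof -
  have "tame (exp (\<alpha> * (t - 0))) (exp (\<beta> * (t - 0))) (\<lambda>u x. SUP xs\<in>subdivisions 0 t. env_list \<Lambda> S xs u x)"
    by (rule tame_SUP[OF subdivisions_nonempty[OF assms]]) (rule env_list_tame)
  moreover have "envelope \<Lambda> S t = (\<lambda>u x. SUP xs\<in>subdivisions 0 t. env_list \<Lambda> S xs u x)"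
    by (rule ext) (rule envelope_eq_SUP_subdivisions[OF assms])
  ultimately show ?thesis
    by simp
qed

lemma env_list_le_envelope:
  assumes "xs \<in> subdivisions 0 t" "u \<in> UC_kappa \<kappa>"
  shows "env_list \<Lambda> S xs u x \<le> envelope \<Lambda> S t u x"
  unfolding envelope_eq_SUP_subdivisions[OF subdivisions_le[OF assms(1)]]
  by (rule cSUP_upper[OF assms(1)], rule tame_bdd_above[OF _ assms(2)], rule env_list_tame)

section \<open>The modulus of continuity\<close>

lemma env_step_drift:
  assumes u: "u \<in> UC_kappa \<kappa>" and h: "0 \<le> h" and drift: "\<And>l. l \<in> \<Lambda> \<Longrightarrow> kclose \<kappa> c (S l h u) u"
  shows "kclose \<kappa> c (env_step \<Lambda> S h u) u"
proof -
  have "kclose \<kappa> c (\<lambda>x. SUP l\<in>\<Lambda>. S l h u x) (\<lambda>x. SUP l\<in>\<Lambda>. u x)"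
    by (intro kclose_SUP[OF ne] tame_bdd_above[OF S_tame[OF _ h] u] drift) auto
  then show ?thesis
    using ne by (simp add: env_step_def)
qed

text \<open>Induction on the partition. Removing the first step \<open>E\<close>, of length \<open>b - s\<close>, the difference
  \<open>E w - u = (E w - E u) + (E u - u)\<close> with \<open>w\<close> the remaining composition is bounded by
  \<open>exp (\<alpha> (b - s))\<close> times the bound for \<open>w - u\<close>, plus \<open>L (b - s)\<close>. The absolute value of \<open>\<alpha>\<close>
  makes the exponential factor at least 1, so that it absorbs the last term as well; only the
  total length of the partition then enters.\<close>

lemma env_list_drift:
  assumes u: "u \<in> UC_kappa \<kappa>" and L: "0 \<le> L"
    and drift: "\<And>h l. 0 \<le> h \<Longrightarrow> h < \<eta> \<Longrightarrow> l \<in> \<Lambda> \<Longrightarrow> kclose \<kappa> (L * h) (S l h u) u"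
    and xs: "xs \<in> subdivisions s t" "t - s < \<eta>"
  shows "kclose \<kappa> (exp (\<bar>\<alpha>\<bar> * (t - s)) * (L * (t - s))) (env_list \<Lambda> S xs u) u"
  using xs
proof (induction xs arbitrary: s rule: induct_list012)
  case 1
  then show ?case by (simp add: subdivisions_def)
next
  case (2 a)
  then show ?case by (auto simp: subdivisions_single kclose_refl)
next
  case (3 a b xs)
  then have *: "a = s" "a < b" "b # xs \<in> subdivisions b t"
    by (auto simp: subdivisions_Cons_Cons)
  have "b \<le> t" by (rule subdivisions_le[OF *(3)])
  have IH: "kclose \<kappa> (exp (\<bar>\<alpha>\<bar> * (t - b)) * (L * (t - b))) (env_list \<Lambda> S (b # xs) u) u"
    using "3.IH"(2)[OF *(3)] "3.prems" * by simp
  have "kclose \<kappa> (exp (\<alpha> * (b - s)) * (exp (\<bar>\<alpha>\<bar> * (t - b)) * (L * (t - b))) + L * (b - s))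
      (env_list \<Lambda> S (a # b # xs) u) u"
    unfolding env_list.simps \<open>a = s\<close>
  proof (rule kclose_trans)
    show "kclose \<kappa> (exp (\<alpha> * (b - s)) * (exp (\<bar>\<alpha>\<bar> * (t - b)) * (L * (t - b))))
        (env_step \<Lambda> S (b - s) (env_list \<Lambda> S (b # xs) u)) (env_step \<Lambda> S (b - s) u)"
      using * by (intro tame_kclose[OF env_step_tame _ u IH] tame_UC_kappa[OF env_list_tame u]) auto
    show "kclose \<kappa> (L * (b - s)) (env_step \<Lambda> S (b - s) u) u"
      using * \<open>b \<le> t\<close> "3.prems"(2) by (intro env_step_drift[OF u] drift) auto
  qed
  then show ?case
  proof (rule kclose_mono)
    have "exp (\<alpha> * (b - s)) * exp (\<bar>\<alpha>\<bar> * (t - b)) \<le> exp (\<bar>\<alpha>\<bar> * (b - s)) * exp (\<bar>\<alpha>\<bar> * (t - b))"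
      using * by (intro mult_right_mono) (auto intro: mult_right_mono)
    also have "\<dots> = exp (\<bar>\<alpha>\<bar> * (t - s))"
      by (rule exp_mult_exp_diff)
    finally have "exp (\<alpha> * (b - s)) * exp (\<bar>\<alpha>\<bar> * (t - b)) * (L * (t - b)) \<le> exp (\<bar>\<alpha>\<bar> * (t - s)) * (L * (t - b))"
      using L \<open>b \<le> t\<close> by (intro mult_right_mono) auto
    moreover have "1 * (L * (b - s)) \<le> exp (\<bar>\<alpha>\<bar> * (t - s)) * (L * (b - s))"
      using L * \<open>b \<le> t\<close> by (intro mult_right_mono) auto
    ultimately show "exp (\<alpha> * (b - s)) * (exp (\<bar>\<alpha>\<bar> * (t - b)) * (L * (t - b))) + L * (b - s)
        \<le> exp (\<bar>\<alpha>\<bar> * (t - s)) * (L * (t - s))"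
      by (simp add: algebra_simps)
  qed
qed

text \<open>Partitions of \<open>[0, s]\<close> and of \<open>[0, t]\<close> are compared by splitting at \<open>s\<close>: the part beyond \<open>s\<close> moves
  \<open>u\<close> by the drift bound, and the composition up to \<open>s\<close> multiplies this error by \<open>exp (\<alpha> s)\<close>.\<close>

lemma envelope_modulus:
  assumes u: "u \<in> UC_kappa \<kappa>" and L: "0 \<le> L"
    and drift: "\<And>h l. 0 \<le> h \<Longrightarrow> h < \<eta> \<Longrightarrow> l \<in> \<Lambda> \<Longrightarrow> kclose \<kappa> (L * h) (S l h u) u"
    and st: "0 \<le> s" "s \<le> t" "t - s < \<eta>"
  shows "kclose \<kappa> (exp (\<bar>\<alpha>\<bar> * t) * (L * (t - s))) (envelope \<Lambda> S t u) (envelope \<Lambda> S s u)"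
    (is "kclose \<kappa> ?c _ _")
proof (cases "s = t")
  case True
  then show ?thesis by (simp add: kclose_refl)
next
  case False
  with st have "s < t" by simp
  have split: "kclose \<kappa> ?c (env_list \<Lambda> S (ys @ s # zs) u) (env_list \<Lambda> S (ys @ [s]) u)"
    if ys: "ys @ [s] \<in> subdivisions 0 s" and zs: "s # zs \<in> subdivisions s t" for ys zs
  proof -
    have "kclose \<kappa> (exp (\<alpha> * (s - 0)) * (exp (\<bar>\<alpha>\<bar> * (t - s)) * (L * (t - s))))
        (env_list \<Lambda> S (ys @ s # zs) u) (env_list \<Lambda> S (ys @ [s]) u)"
      unfolding env_list_append[of \<Lambda> S ys s zs]
      by (rule tame_kclose[OF env_list_tame[OF ys] tame_UC_kappa[OF env_list_tame[OF zs] u] u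
            env_list_drift[OF u L drift zs st(3)]])
    then show ?thesis
    proof (rule kclose_mono)
      have "exp (\<alpha> * (s - 0)) * exp (\<bar>\<alpha>\<bar> * (t - s)) \<le> exp (\<bar>\<alpha>\<bar> * s) * exp (\<bar>\<alpha>\<bar> * (t - s))"
        using st by (intro mult_right_mono) (auto intro: mult_right_mono)
      also have "\<dots> = exp (\<bar>\<alpha>\<bar> * t)"
        by (simp add: mult_exp_exp right_diff_distrib)
      finally have "exp (\<alpha> * (s - 0)) * exp (\<bar>\<alpha>\<bar> * (t - s)) * (L * (t - s)) \<le> ?c"
        using L st by (intro mult_right_mono) auto
      then show "exp (\<alpha> * (s - 0)) * (exp (\<bar>\<alpha>\<bar> * (t - s)) * (L * (t - s))) \<le> ?c"
        by (simp add: mult.assoc)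
    qed
  qed
  show ?thesis
    unfolding kclose_iff_le
  proof (intro conjI allI)
    fix x
    have "0 \<le> t" using st by simp
    \<comment> \<open>An arbitrary partition of \<open>[0, t]\<close> is first refined by \<open>s\<close>.\<close>
    show "envelope \<Lambda> S t u x \<le> envelope \<Lambda> S s u x + ?c / \<kappa> x"
      unfolding envelope_eq_SUP_subdivisions[OF \<open>0 \<le> t\<close>]
    proof (rule cSUP_least[OF subdivisions_nonempty[OF \<open>0 \<le> t\<close>]])
      fix xs assume "xs \<in> subdivisions 0 t"
      then obtain ys zs where yz: "ys @ [s] \<in> subdivisions 0 s" "s # zs \<in> subdivisions s t"
        and le: "env_list \<Lambda> S xs u \<le> env_list \<Lambda> S (ys @ s # zs) u"
        using subdivision_refinement[of xs 0 t s] st u by metis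
      have "env_list \<Lambda> S xs u x \<le> env_list \<Lambda> S (ys @ s # zs) u x"
        using le by (simp add: le_fun_def)
      also have "\<dots> \<le> env_list \<Lambda> S (ys @ [s]) u x + ?c / \<kappa> x"
        using split[OF yz] unfolding kclose_iff_le by blast
      also have "\<dots> \<le> envelope \<Lambda> S s u x + ?c / \<kappa> x"
        using env_list_le_envelope[OF yz(1) u] by simp
      finally show "env_list \<Lambda> S xs u x \<le> envelope \<Lambda> S s u x + ?c / \<kappa> x" .
    qed
    \<comment> \<open>A partition of \<open>[0, s]\<close> is extended by the single step from \<open>s\<close> to \<open>t\<close>.\<close>
    show "envelope \<Lambda> S s u x \<le> envelope \<Lambda> S t u x + ?c / \<kappa> x"
      unfolding envelope_eq_SUP_subdivisions[OF \<open>0 \<le> s\<close>]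
    proof (rule cSUP_least[OF subdivisions_nonempty[OF \<open>0 \<le> s\<close>]])
      fix xs assume xs: "xs \<in> subdivisions 0 s"
      then have eq: "xs = butlast xs @ [s]"
        by (auto simp: subdivisions_def)
      have "s # [t] \<in> subdivisions s t"
        using \<open>s < t\<close> by (simp add: subdivisions_Cons_Cons subdivisions_single)
      then have "env_list \<Lambda> S xs u x \<le> env_list \<Lambda> S (butlast xs @ s # [t]) u x + ?c / \<kappa> x"
        using split[of "butlast xs" "[t]"] xs eq unfolding kclose_iff_le by metis
      also have "butlast xs @ s # [t] = xs @ [t]"
        using eq by (metis append.assoc append_Cons append_Nil)
      also have "xs @ [t] \<in> subdivisions 0 t"
        using xs \<open>s < t\<close> by (cases xs rule: rev_cases) (auto simp: subdivisions_def sorted_wrt_append hd_append intro: less_trans)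
      then have "env_list \<Lambda> S (xs @ [t]) u x + ?c / \<kappa> x \<le> envelope \<Lambda> S t u x + ?c / \<kappa> x"
        using env_list_le_envelope[OF _ u] by simp
      finally show "env_list \<Lambda> S xs u x \<le> envelope \<Lambda> S t u x + ?c / \<kappa> x" .
    qed
  qed
qed

section \<open>Strong continuity\<close>

lemma D_Lambda_iff:
  "u \<in> D_Lambda \<kappa> \<Lambda> S \<longleftrightarrow> u \<in> UC_kappa \<kappa> \<and>
    (\<exists>L\<ge>0. \<exists>\<eta>>0. \<forall>h l. 0 \<le> h \<longrightarrow> h < \<eta> \<longrightarrow> l \<in> \<Lambda> \<longrightarrow> kclose \<kappa> (L * h) (S l h u) u)"
proof -
  have "(\<forall>h\<in>{0..<\<eta>}. (SUP l\<in>\<Lambda>. knorm \<kappa> (\<lambda>x. S l h u x - u x)) \<le> ennreal (L * h)) \<longleftrightarrow>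
    (\<forall>h l. 0 \<le> h \<longrightarrow> h < \<eta> \<longrightarrow> l \<in> \<Lambda> \<longrightarrow> kclose \<kappa> (L * h) (S l h u) u)" if "0 \<le> L" for L \<eta>
    using that by (auto simp: SUP_le_iff knorm_diff_le_iff)
  then show ?thesis
    unfolding D_Lambda_def by blast
qed

lemma D_Lambda_linear_combination:
  assumes "u \<in> D_Lambda \<kappa> \<Lambda> S" "v \<in> D_Lambda \<kappa> \<Lambda> S"
  shows "(\<lambda>x. a * u x + b * v x) \<in> D_Lambda \<kappa> \<Lambda> S"
proof -
  obtain L \<eta> where u: "u \<in> UC_kappa \<kappa>" "0 \<le> L" "0 < \<eta>"
    "\<And>h l. 0 \<le> h \<Longrightarrow> h < \<eta> \<Longrightarrow> l \<in> \<Lambda> \<Longrightarrow> kclose \<kappa> (L * h) (S l h u) u"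
    using assms(1) unfolding D_Lambda_iff by blast
  obtain L' \<eta>' where v: "v \<in> UC_kappa \<kappa>" "0 \<le> L'" "0 < \<eta>'"
    "\<And>h l. 0 \<le> h \<Longrightarrow> h < \<eta>' \<Longrightarrow> l \<in> \<Lambda> \<Longrightarrow> kclose \<kappa> (L' * h) (S l h v) v"
    using assms(2) unfolding D_Lambda_iff by blast
  have "kclose \<kappa> ((\<bar>a\<bar> * L + \<bar>b\<bar> * L') * h) (S l h (\<lambda>x. a * u x + b * v x)) (\<lambda>x. a * u x + b * v x)"
    if h: "0 \<le> h" "h < min \<eta> \<eta>'" and l: "l \<in> \<Lambda>" for h l
  proof -
    have "kclose \<kappa> (\<bar>a\<bar> * (L * h) + \<bar>b\<bar> * (L' * h)) (\<lambda>x. a * S l h u x + b * S l h v x) (\<lambda>x. a * u x + b * v x)"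
      using h l by (intro kclose_linear_combination u(4) v(4)) auto
    then show ?thesis
      by (simp add: S_linear[OF l h(1) u(1) v(1)] algebra_simps)
  qed
  then show ?thesis
    unfolding D_Lambda_iff
    using UC_kappa_linear_combination[OF u(1) v(1)] u(2,3) v(2,3)
    by (intro conjI exI[of _ "\<bar>a\<bar> * L + \<bar>b\<bar> * L'"] exI[of _ "min \<eta> \<eta>'"]) auto
qed

lemma zero_in_D_Lambda: "(\<lambda>_. 0) \<in> D_Lambda \<kappa> \<Lambda> S"
  unfolding D_Lambda_iff
  by (intro conjI const_in_UC_kappa exI[of _ 0] exI[of _ 1]) (auto simp: S_const kclose_refl)

text \<open>The envelope is locally Lipschitz in time on \<open>D_Lambda\<close>, and near a given \<open>t\<close> the operators are
  Lipschitz with a common constant, so the approximation of \<open>u\<close> by elements of \<open>D_Lambda\<close> is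
  uniform in time.\<close>

theorem envelope_strongly_continuous:
  "strongly_continuous_on \<kappa> (UC_kappa_top \<kappa> closure_of D_Lambda \<kappa> \<Lambda> S) (envelope \<Lambda> S)"
  unfolding strongly_continuous_on_def
proof (intro ballI continuous_map_UC_kappaI)
  fix u assume "u \<in> UC_kappa_top \<kappa> closure_of D_Lambda \<kappa> \<Lambda> S"
  moreover have "D_Lambda \<kappa> \<Lambda> S \<subseteq> UC_kappa \<kappa>"
    by (auto simp: D_Lambda_def)
  ultimately have u: "u \<in> UC_kappa \<kappa>" and approx: "\<And>\<epsilon>. 0 < \<epsilon> \<Longrightarrow> \<exists>v\<in>D_Lambda \<kappa> \<Lambda> S. kclose \<kappa> \<epsilon> u v"
    by (auto simp: closure_UC_kappa_iff)
  show "envelope \<Lambda> S t u \<in> UC_kappa \<kappa>" if "t \<in> {0..}" for t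
    using tame_UC_kappa[OF envelope_tame u] that by simp
  fix t \<epsilon> :: real assume "t \<in> {0..}" and \<epsilon>: "0 < \<epsilon>"
  then have t: "0 \<le> t" by simp
  \<comment> \<open>\<open>K\<close> bounds all exponential factors at times up to \<open>t + 1\<close>. The error \<open>\<epsilon>\<close> is shared out as
    \<open>\<epsilon> / 4\<close> for each passage between \<open>u\<close> and \<open>v\<close> and \<open>\<epsilon> / 2\<close> for the change of time.\<close>
  define K where "K = exp (\<bar>\<alpha>\<bar> * (t + 1))"
  have K: "0 < K" by (simp add: K_def)
  obtain v where "v \<in> D_Lambda \<kappa> \<Lambda> S" and uv: "kclose \<kappa> (\<epsilon> / (4 * K)) u v"
    using approx[of "\<epsilon> / (4 * K)"] \<epsilon> K by auto
  then obtain L \<eta> where v: "v \<in> UC_kappa \<kappa>" and L: "0 \<le> L" and \<eta>: "0 < \<eta>"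
    and drift: "\<And>h l. 0 \<le> h \<Longrightarrow> h < \<eta> \<Longrightarrow> l \<in> \<Lambda> \<Longrightarrow> kclose \<kappa> (L * h) (S l h v) v"
    unfolding D_Lambda_iff by blast
  have uv': "kclose \<kappa> (\<epsilon> / 4) (envelope \<Lambda> S r u) (envelope \<Lambda> S r v)" if r: "0 \<le> r" "r \<le> t + 1" for r
  proof (rule kclose_mono[OF tame_kclose[OF envelope_tame[OF r(1)] u v uv]])
    have "\<alpha> * r \<le> \<bar>\<alpha>\<bar> * (t + 1)"
      using r by (intro mult_mono) auto
    then have "exp (\<alpha> * r) * (\<epsilon> / (4 * K)) \<le> K * (\<epsilon> / (4 * K))"
      using \<epsilon> K by (intro mult_right_mono) (auto simp: K_def)
    then show "exp (\<alpha> * r) * (\<epsilon> / (4 * K)) \<le> \<epsilon> / 4"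
      using K by simp
  qed
  have vv: "kclose \<kappa> (K * (L * \<bar>p - r\<bar>)) (envelope \<Lambda> S p v) (envelope \<Lambda> S r v)"
    if "0 \<le> p" "0 \<le> r" "p \<le> t + 1" "r \<le> t + 1" "\<bar>p - r\<bar> < \<eta>" for p r
    using that
  proof (induction p r rule: linorder_wlog)
    case (le p r)
    have "exp (\<bar>\<alpha>\<bar> * r) * (L * (r - p)) \<le> K * (L * (r - p))"
      using le L by (intro mult_right_mono) (auto simp: K_def mult_left_mono)
    moreover have "kclose \<kappa> (exp (\<bar>\<alpha>\<bar> * r) * (L * (r - p))) (envelope \<Lambda> S r v) (envelope \<Lambda> S p v)"
      using le by (intro envelope_modulus[OF v L drift]) auto
    ultimately show ?case
      using le(1) kclose_mono by (simp add: kclose_sym[of \<kappa> _ "envelope \<Lambda> S p v"])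
  next
    case (sym p r)
    then show ?case
      by (simp add: kclose_sym[of \<kappa> _ "envelope \<Lambda> S p v"] abs_minus_commute)
  qed
  define \<delta> where "\<delta> = min (min 1 \<eta>) (\<epsilon> / (2 * K * (L + 1)))"
  show "\<exists>\<delta>>0. \<forall>s\<in>{0..}. \<bar>s - t\<bar> < \<delta> \<longrightarrow> kclose \<kappa> \<epsilon> (envelope \<Lambda> S t u) (envelope \<Lambda> S s u)"
  proof (intro exI conjI ballI impI)
    show "0 < \<delta>"
      using \<epsilon> K L \<eta> by (simp add: \<delta>_def)
    fix s assume "s \<in> {0..}" and st: "\<bar>s - t\<bar> < \<delta>"
    then have s: "0 \<le> s" "s \<le> t + 1" "\<bar>t - s\<bar> < \<eta>" "\<bar>t - s\<bar> \<le> \<epsilon> / (2 * K * (L + 1))"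
      by (auto simp: \<delta>_def)
    have "K * (L * \<bar>t - s\<bar>) \<le> K * ((L + 1) * (\<epsilon> / (2 * K * (L + 1))))"
      using K L s(4) by (intro mult_left_mono mult_mono) auto
    also have "\<dots> = \<epsilon> / 2"
    proof -
      have "K \<noteq> 0" "L + 1 \<noteq> 0"
        using K L by linarith+
      then show ?thesis by simp
    qed
    finally have "K * (L * \<bar>t - s\<bar>) \<le> \<epsilon> / 2" .
    then have "kclose \<kappa> (\<epsilon> / 2) (envelope \<Lambda> S t v) (envelope \<Lambda> S s v)"
      using kclose_mono[OF vv[of t s]] s t by simp
    moreover have "kclose \<kappa> (\<epsilon> / 4) (envelope \<Lambda> S t u) (envelope \<Lambda> S t v)"
      "kclose \<kappa> (\<epsilon> / 4) (envelope \<Lambda> S s v) (envelope \<Lambda> S s u)"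
      using uv'[of t] uv'[of s] s t by (auto simp: kclose_sym[of \<kappa> _ "envelope \<Lambda> S s v"])
    ultimately have "kclose \<kappa> (\<epsilon> / 4 + \<epsilon> / 2 + \<epsilon> / 4) (envelope \<Lambda> S t u) (envelope \<Lambda> S s u)"
      using kclose_trans by blast
    then show "kclose \<kappa> \<epsilon> (envelope \<Lambda> S t u) (envelope \<Lambda> S s u)"
      by simp
  qed
qed

end

theorem proposition3p5:
  fixes \<Lambda> :: "'l set"
    and \<kappa> :: "'a::metric_space \<Rightarrow> real"
    and S :: "'l \<Rightarrow> real \<Rightarrow> ('a \<Rightarrow> real) \<Rightarrow> 'a \<Rightarrow> real"
    and \<alpha> \<beta> :: real
  assumes "\<Lambda> \<noteq> {}"
    and "separable_space (euclidean :: 'a topology)"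
    and "\<And>x. \<kappa> x > 0" and "continuous_on UNIV \<kappa>" and "bounded (range \<kappa>)"
    and "\<And>l. l \<in> \<Lambda> \<Longrightarrow> feller_semigroup \<kappa> (S l)"
    and "\<And>l t. l \<in> \<Lambda> \<Longrightarrow> t \<ge> 0 \<Longrightarrow> linear_on_UC \<kappa> (S l t)"
    and "\<And>l t. l \<in> \<Lambda> \<Longrightarrow> t \<ge> 0 \<Longrightarrow> S l t (\<lambda>_. 1) = (\<lambda>_. 1)"
    and "\<And>l t u. l \<in> \<Lambda> \<Longrightarrow> t \<ge> 0 \<Longrightarrow> u \<in> Lip_b \<Longrightarrow>
           knorm \<kappa> (S l t u) \<le> ennreal (exp (\<alpha> * t)) * knorm \<kappa> u"
    and "\<And>l t u. l \<in> \<Lambda> \<Longrightarrow> t \<ge> 0 \<Longrightarrow> u \<in> Lip_b \<Longrightarrow>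
           lip_norm (S l t u) \<le> ennreal (exp (\<beta> * t)) * lip_norm u"
  shows "((\<lambda>_. 0) \<in> D_Lambda \<kappa> \<Lambda> S \<and>
          (\<forall>u\<in>D_Lambda \<kappa> \<Lambda> S. \<forall>v\<in>D_Lambda \<kappa> \<Lambda> S. \<forall>a b.
             (\<lambda>x. a * u x + b * v x) \<in> D_Lambda \<kappa> \<Lambda> S)) \<and>
         strongly_continuous_on \<kappa> (UC_kappa_top \<kappa> closure_of D_Lambda \<kappa> \<Lambda> S) (envelope \<Lambda> S) \<and>
         (UC_kappa_top \<kappa> closure_of D_Lambda \<kappa> \<Lambda> S = UC_kappa \<kappa> \<longrightarrow>
            strongly_continuous_on \<kappa> (UC_kappa \<kappa>) (envelope \<Lambda> S))"
proof -
  interpret linear_feller_family \<kappa> \<Lambda> S \<alpha> \<beta>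
    using assms by unfold_locales
  have "strongly_continuous_on \<kappa> (UC_kappa_top \<kappa> closure_of D_Lambda \<kappa> \<Lambda> S) (envelope \<Lambda> S)"
    by (rule envelope_strongly_continuous)
  then show ?thesis
    using zero_in_D_Lambda D_Lambda_linear_combination by metis
qed

end
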